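(* Let $\nu$ be a non-zero finite Borel measure on $(0,1)$ and let $q\in[0,1]$. If $\beta_\nu(q)=\lim_{n\to\infty}\beta_n^\nu(q)$ (the limit exists) and $-\partial\beta_\nu(q)=[a,b]$ with real numbers $a\le b$, then $$\frac{aq+\beta_\nu(q)}{1+b}\le\underline s_\nu .$$
   Context: $\Lambda$ is Lebesgue measure. For $n\in\mathbb N$ and $0\le k<2^n$ let $A^n_k:=(k2^{-n},(k+1)2^{-n}]$ and $\mathcal D_{\nu,n}:=\{A^n_k:\nu(A^n_k)>0\}$. For $q\in\mathbb R$ put $\beta^\nu_n(q):=\frac{1}{\log 2^n}\log\sum_{C\in\mathcal D_{\nu,n}}\nu(C)^q$ and $\beta_\nu(q):=\limsup_{n\to\infty}\beta_n^\nu(q)$ (possibly $+\infty$ for $q<0$). The subdifferential is $\partial\beta_\nu(q):=\{c\in\mathbb R:\ \beta_\nu(t)\ge c(t-q)+\beta_\nu(q)\ \text{for all }t\in\mathbb R\}$, and $-\partial\beta_\nu(q)=\{-c:c\in\partial\beta_\nu(q)\}$. Lower spectral dimension. $\nu$ is regarded as a measure on $[0,1]$. $H^1_0(0,1)$ is the space of functions $f:[0,1]\to\mathbb R$ with $f(x)=\int_{[0,x]}g\,d\Lambda$ for some $g\in L^2_\Lambda([0,1])$ and $f(0)=f(1)=0$; $\nabla_\Lambda f:=g$. $C_\nu([0,1])$ is the set of continuous real functions on $[0,1]$ that are affine linear on every connected component of $[0,1]\setminus\operatorname{supp}\nu$. $\operatorname{dom}(\mathcal E_\nu):=H^1_0(0,1)\cap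 C_\nu([0,1])$, $\mathcal E_\nu(f,g):=\int_{(0,1)}\nabla_\Lambda f\,\nabla_\Lambda g\,d\Lambda$. A number $\lambda$ is an eigenvalue of $\mathcal E_\nu$ if there is $f\in\operatorname{dom}(\mathcal E_\nu)\setminus\{0\}$ with $\mathcal E_\nu(f,g)=\lambda\int fg\,d\nu$ for all $g\in\operatorname{dom}(\mathcal E_\nu)$. $N_\nu(x)$ is the number of eigenvalues $\le x$ (with multiplicity). $\underline{s}_\nu:=\liminf_{x\to\infty}\frac{\log N_\nu(x)}{\log x}$. *)

theory Defs
  imports "HOL-Analysis.Analysis" "HOL-Library.Function_Algebras"
begin

text \<open>
  A Borel measure on \<open>(0,1)\<close> is represented by a measure on the Borel sets of the real line for
  which the complement of \<open>(0,1)\<close> is a null set.  This makes \<open>\<nu>\<close> available on the half-open cells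
  \<open>(k 2\<^sup>-\<^sup>n, (k+1) 2\<^sup>-\<^sup>n]\<close>, the last of which contains the point 1, and on \<open>[0,1]\<close>.
\<close>

definition dyadic_cell :: "nat \<Rightarrow> nat \<Rightarrow> real set" where
  "dyadic_cell n k = {real k / 2 ^ n <.. (real k + 1) / 2 ^ n}"

definition charged_cells :: "real measure \<Rightarrow> nat \<Rightarrow> real set set" where
  "charged_cells \<nu> n = {dyadic_cell n k | k. k < 2 ^ n \<and> measure \<nu> (dyadic_cell n k) > 0}"

text \<open>For \<open>n = 0\<close> the denominator is 0; this has no influence on limits as \<open>n \<rightarrow> \<infinity>\<close>.\<close>

definition beta_n :: "real measure \<Rightarrow> nat \<Rightarrow> real \<Rightarrow> real" where
  "beta_n \<nu> n q = ln (\<Sum>C\<in>charged_cells \<nu> n. measure \<nu> C powr q) / ln (2 ^ n)"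

definition beta :: "real measure \<Rightarrow> real \<Rightarrow> ereal" where
  "beta \<nu> q = limsup (\<lambda>n. ereal (beta_n \<nu> n q))"

definition subdiff_beta :: "real measure \<Rightarrow> real \<Rightarrow> real set" where
  "subdiff_beta \<nu> q = {c. \<forall>t. beta \<nu> t \<ge> ereal (c * (t - q)) + beta \<nu> q}"

definition supp_measure :: "real measure \<Rightarrow> real set" where
  "supp_measure \<nu> = {x. \<forall>U. open U \<and> x \<in> U \<longrightarrow> emeasure \<nu> U > 0}"

text \<open>\<open>g\<close> represents a class in \<open>L\<^sup>2([0,1])\<close> that is a weak derivative of \<open>f\<close>.\<close>

definition has_L2_gradient :: "(real \<Rightarrow> real) \<Rightarrow> (real \<Rightarrow> real) \<Rightarrow> bool" where
  "has_L2_gradient f g \<longleftrightarrow>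
     set_borel_measurable lborel {0..1} g \<and>
     set_integrable lborel {0..1} (\<lambda>x. (g x)\<^sup>2) \<and>
     (\<forall>x\<in>{0..1}. f x = (LINT t:{0..x}|lborel. g t))"

text \<open>Only the almost everywhere class on \<open>[0,1]\<close> of the selected gradient is determined by \<open>f\<close>.\<close>

definition gradient :: "(real \<Rightarrow> real) \<Rightarrow> real \<Rightarrow> real" where
  "gradient f = (SOME g. has_L2_gradient f g)"

text \<open>
  Functions on \<open>[0,1]\<close> are represented by their extension by zero to the real line, so that equality
  and linear independence in the function space refer to the values on \<open>[0,1]\<close>.
\<close>

definition H10 :: "(real \<Rightarrow> real) set" where
  "H10 = {f. (\<exists>g. has_L2_gradient f g) \<and> f 0 = 0 \<and> f 1 = 0 \<and> (\<forall>x. x \<notin> {0..1} \<longrightarrow> f x = 0)}"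

definition C_nu :: "real measure \<Rightarrow> (real \<Rightarrow> real) set" where
  "C_nu \<nu> = {f. continuous_on {0..1} f \<and>
     (\<forall>K\<in>components ({0..1} - supp_measure \<nu>). \<exists>c d. \<forall>x\<in>K. f x = c * x + d)}"

definition dom_E :: "real measure \<Rightarrow> (real \<Rightarrow> real) set" where
  "dom_E \<nu> = H10 \<inter> C_nu \<nu>"

text \<open>The form depends on \<open>\<nu>\<close> only through its domain.\<close>

definition E_form :: "(real \<Rightarrow> real) \<Rightarrow> (real \<Rightarrow> real) \<Rightarrow> real" where
  "E_form f g = (LINT x:{0<..<1}|lborel. gradient f x * gradient g x)"

definition eigenspace :: "real measure \<Rightarrow> real \<Rightarrow> (real \<Rightarrow> real) set" where
  "eigenspace \<nu> l = {f \<in> dom_E \<nu>. \<forall>g\<in>dom_E \<nu>. E_form f g = l * (LINT x|\<nu>. f x * g x)}"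

definition eigenvalue :: "real measure \<Rightarrow> real \<Rightarrow> bool" where
  "eigenvalue \<nu> l \<longleftrightarrow> (\<exists>f\<in>eigenspace \<nu> l. f \<noteq> 0)"

global_interpretation fun_space: vector_space "\<lambda>(c::real) (f::real \<Rightarrow> real) x. c * f x"
  by standard (auto simp: fun_eq_iff algebra_simps)

text \<open>The dimension of the eigenspace, with value \<open>\<infinity>\<close> if it is not finite-dimensional.\<close>

definition multiplicity_E :: "real measure \<Rightarrow> real \<Rightarrow> enat" where
  "multiplicity_E \<nu> l =
     Sup {enat (card B) | B. finite B \<and> B \<subseteq> eigenspace \<nu> l \<and> fun_space.independent B}"

definition N_count :: "real measure \<Rightarrow> real \<Rightarrow> enat" where
  "N_count \<nu> x = (\<Sum>\<^sub>\<infinity>l\<in>{l. eigenvalue \<nu> l \<and> l \<le> x}. multiplicity_E \<nu> l)"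

definition ln_enat :: "enat \<Rightarrow> ereal" where
  "ln_enat m = (case m of enat k \<Rightarrow> if k = 0 then -\<infinity> else ereal (ln (real k)) | \<infinity> \<Rightarrow> \<infinity>)"

definition lower_spectral_dim :: "real measure \<Rightarrow> ereal" where
  "lower_spectral_dim \<nu> = Liminf at_top (\<lambda>x::real. ln_enat (N_count \<nu> x) / ereal (ln x))"

end

theory Submission
  imports Defs "HOL-Complex_Analysis.Great_Picard" "HOL-Real_Asymp.Real_Asymp"
begin

text \<open>
  The counting function is bounded below variationally.  On all of \<open>H\<^sub>0\<^sup>1(0,1)\<close> the form
  \<open>\<integral> f g d\<nu>\<close> is compact relative to the energy form, so as long as some \<open>f\<close> orthogonal to the
  eigenfunctions found so far has Rayleigh quotient at most \<open>x\<close>, the maximum of \<open>\<integral> f\<^sup>2 d\<nu>\<close> over the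
  energy unit ball of their orthogonal complement is attained at a further eigenfunction with
  eigenvalue at most \<open>x\<close>.  Testing with tents supported off \<open>supp \<nu>\<close> shows that such an eigenfunction
  is affine on the gaps of the support, so nothing is lost by leaving \<open>dom(E)\<close>.  Tents over dyadic
  cells \<open>C\<close> of level \<open>n\<close> with \<open>\<nu>(C) \<ge> \<delta>\<close> have disjoint supports after splitting into three classes,
  hence \<open>N(x)\<close> is at least a third of the number of such cells (up to the two boundary cells) once
  \<open>x \<ge> 3 \<cdot> 2\<^sup>n / \<delta>\<close>.

  For the number of cells: since \<open>- a + \<epsilon>\<close> and \<open>- b - \<epsilon>\<close> are not subgradients of \<open>\<beta>\<close> at \<open>q\<close>, the cells
  with mass above \<open>2 powr (- n (a - \<epsilon>))\<close> or below \<open>2 powr (- n (b + \<epsilon>))\<close> contribute an exponentially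
  small part of \<open>\<Sum> \<nu>(C) powr q\<close>.  Each remaining term is at most \<open>2 powr (- n (a - \<epsilon>) q)\<close>, so there are
  about \<open>2 powr (n (\<beta>(q) + a q))\<close> cells with mass at least \<open>2 powr (- n (b + \<epsilon>))\<close>, which is used
  with \<open>x\<close> of order \<open>2 powr (n (1 + b + \<epsilon>))\<close>.
\<close>

section \<open>Variational construction of eigenvectors by maximizing one quadratic form against
  another\<close>

section \<open>Eigenvectors of a compact pair of forms\<close>

text \<open>The axioms are restricted to \<open>H\<close> because the energy form is meaningful only
  for functions that have a gradient. Only semidefiniteness is demanded: the
  \<open>\<nu>\<close>-form vanishes on every function that is zero \<open>\<nu>\<close>-almost
  everywhere.\<close>

locale semi_inner = vector_space scale
  for scale :: "real \<Rightarrow> 'b::ab_group_add \<Rightarrow> 'b" (infixr "\<cdot>" 75) +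
  fixes H :: "'b set" and E :: "'b \<Rightarrow> 'b \<Rightarrow> real"
  assumes subspace_H: "subspace H"
    and sym: "f \<in> H \<Longrightarrow> g \<in> H \<Longrightarrow> E f g = E g f"
    and add_left: "f \<in> H \<Longrightarrow> g \<in> H \<Longrightarrow> h \<in> H \<Longrightarrow> E (f + g) h = E f h + E g h"
    and scale_left: "f \<in> H \<Longrightarrow> g \<in> H \<Longrightarrow> E (c \<cdot> f) g = c * E f g"
    and nonneg: "f \<in> H \<Longrightarrow> 0 \<le> E f f"
begin

lemmas mem [simp] = subspace_0[OF subspace_H] subspace_add[OF subspace_H]
  subspace_scale[OF subspace_H] subspace_diff[OF subspace_H] subspace_sum[OF subspace_H]

lemma add_right: "f \<in> H \<Longrightarrow> g \<in> H \<Longrightarrow> h \<in> H \<Longrightarrow> E h (f + g) = E h f + E h g"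
  using add_left[of f g h] by (simp add: sym[of h])

lemma scale_right: "f \<in> H \<Longrightarrow> g \<in> H \<Longrightarrow> E g (c \<cdot> f) = c * E g f"
  using scale_left[of f g c] by (simp add: sym[of g])

lemma diff_left: "f \<in> H \<Longrightarrow> g \<in> H \<Longrightarrow> h \<in> H \<Longrightarrow> E (f - g) h = E f h - E g h"
  using add_left[of "f - g" g h] by simp

lemma diff_right: "f \<in> H \<Longrightarrow> g \<in> H \<Longrightarrow> h \<in> H \<Longrightarrow> E h (f - g) = E h f - E h g"
  using add_right[of "f - g" g h] by simp

lemma zero_left: "f \<in> H \<Longrightarrow> E 0 f = 0"
  using add_left[of 0 0 f] by simp

lemma sum_left: "(\<And>i. i \<in> I \<Longrightarrow> F i \<in> H) \<Longrightarrow> h \<in> H \<Longrightarrow> E (sum F I) h = (\<Sum>i\<in>I. E (F i) h)"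
proof (induction I rule: infinite_finite_induct)
  case (insert i I)
  then show ?case by (simp add: add_left)
qed (auto simp: zero_left)

lemma sum_right: "(\<And>i. i \<in> I \<Longrightarrow> F i \<in> H) \<Longrightarrow> h \<in> H \<Longrightarrow> E h (sum F I) = (\<Sum>i\<in>I. E h (F i))"
  by (simp add: sym[of h] sum_left)

lemmas bilinear = add_left add_right diff_left diff_right scale_left scale_right

text \<open>Nonnegativity of the quadratic polynomial
  \<open>t \<mapsto> E (f - t g) (f - t g)\<close>. The case \<open>E g g = 0\<close> is separate
  because a null vector need not be zero.\<close>

lemma cauchy_schwarz:
  assumes [simp]: "f \<in> H" "g \<in> H"
  shows "(E f g)\<^sup>2 \<le> E f f * E g g"
proof -
  have ineq: "0 \<le> E f f - 2 * t * E f g + t\<^sup>2 * E g g" for t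
    using nonneg[of "f - t \<cdot> g"]
    by (simp add: bilinear sym[of g f] power2_eq_square algebra_simps)
  show ?thesis
  proof (cases "E g g = 0")
    case True
    have "E f g = 0"
    proof (rule ccontr)
      assume "E f g \<noteq> 0"
      \<comment> \<open>This \<open>t\<close> makes the polynomial, which is affine here, equal to
        -1.\<close>
      then show False
        using ineq[of "(E f f + 1) / (2 * E f g)"] True nonneg[of f] by simp
    qed
    with True show ?thesis by simp
  next
    case False
    then have pos: "E g g > 0" using nonneg[of g] by simp
    have "0 \<le> E f f - (E f g)\<^sup>2 / E g g"
      using ineq[of "E f g / E g g"] pos by (simp add: field_simps power2_eq_square)
    then show ?thesis using pos by (simp add: field_simps)
  qed
qed

lemma tendsto_left:
  assumes F: "\<And>n. F n \<in> H" and [simp]: "f \<in> H" "g \<in> H"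
    and lim: "(\<lambda>n. E (F n - f) (F n - f)) \<longlonglongrightarrow> 0"
  shows "(\<lambda>n. E (F n) g) \<longlonglongrightarrow> E f g"
proof -
  note [simp] = F
  have "(\<lambda>n. sqrt (E (F n - f) (F n - f) * E g g)) \<longlonglongrightarrow> sqrt (0 * E g g)"
    by (intro tendsto_intros lim)
  then have "(\<lambda>n. E (F n - f) g) \<longlonglongrightarrow> 0"
    by (intro Lim_null_comparison[OF _ \<open>_ \<longlonglongrightarrow> sqrt (0 * E g g)\<close>[simplified]] always_eventually allI)
       (auto intro!: real_le_rsqrt cauchy_schwarz)
  then have "(\<lambda>n. E (F n - f) g + E f g) \<longlonglongrightarrow> 0 + E f g"
    by (intro tendsto_intros)
  then show ?thesis by (simp add: diff_left)
qed

lemma tendsto_norm: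
  assumes F: "\<And>n. F n \<in> H" and [simp]: "f \<in> H"
    and lim: "(\<lambda>n. E (F n - f) (F n - f)) \<longlonglongrightarrow> 0"
  shows "(\<lambda>n. E (F n) (F n)) \<longlonglongrightarrow> E f f"
proof -
  note [simp] = F
  have "(\<lambda>n. E (F n - f) (F n - f) + 2 * E (F n) f - E f f) \<longlonglongrightarrow> 0 + 2 * E f f - E f f"
    by (intro tendsto_intros lim tendsto_left) auto
  moreover have "E (F n - f) (F n - f) + 2 * E (F n) f - E f f = E (F n) (F n)" for n
    by (simp add: bilinear sym[of f "F n"])
  ultimately show ?thesis by simp
qed

end

text \<open>Gaussian elimination by induction on the number of equations. It later provides a
  nonzero combination of \<open>m\<close> vectors that is orthogonal to fewer than \<open>m\<close>
  given ones.\<close>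

lemma nontrivial_kernel:
  fixes A :: "'i \<Rightarrow> nat \<Rightarrow> real"
  assumes "finite I" "k < card I"
  shows "\<exists>c. (\<exists>i\<in>I. c i \<noteq> 0) \<and> (\<forall>j<k. (\<Sum>i\<in>I. c i * A i j) = 0)"
  using assms
proof (induction k arbitrary: I A)
  case 0
  then show ?case by (intro exI[of _ "\<lambda>_. 1"]) (auto simp: card_gt_0_iff)
next
  case (Suc k)
  show ?case
  proof (cases "\<forall>i\<in>I. A i k = 0")
    case True
    obtain c where "\<exists>i\<in>I. c i \<noteq> 0" "\<forall>j<k. (\<Sum>i\<in>I. c i * A i j) = 0"
      using Suc.IH[of I A] Suc.prems by auto
    with True show ?thesis by (intro exI[of _ c]) (auto simp: less_Suc_eq)
  next
    case False
    then obtain p where p: "p \<in> I" "A p k \<noteq> 0" by blast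
    \<comment> \<open>The unknown \<open>p\<close> is eliminated through equation \<open>k\<close>;
      the value of \<open>d p\<close> below is the one that solves this equation.\<close>
    define A' where "A' i j = A i j - A i k / A p k * A p j" for i j
    have "k < card (I - {p})" using Suc.prems p by simp
    then obtain c where c: "\<exists>i\<in>I - {p}. c i \<noteq> 0"
        "\<And>j. j < k \<Longrightarrow> (\<Sum>i\<in>I - {p}. c i * A' i j) = 0"
      using Suc.IH[of "I - {p}" A'] Suc.prems by auto
    define d where "d i = (if i = p then - (\<Sum>i\<in>I - {p}. c i * A i k) / A p k else c i)" for i
    have sum_d: "(\<Sum>i\<in>I. d i * A i j) = (\<Sum>i\<in>I - {p}. c i * A' i j)" for j
    proof -
      have "(\<Sum>i\<in>I. d i * A i j) = d p * A p j + (\<Sum>i\<in>I - {p}. c i * A i j)"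
        using Suc.prems p by (simp add: sum.remove[of I p] d_def)
      also have "d p * A p j = - (\<Sum>i\<in>I - {p}. c i * (A i k / A p k * A p j))"
        by (simp add: d_def sum_distrib_right sum_divide_distrib sum_negf mult.assoc)
      finally show ?thesis
        by (simp add: A'_def algebra_simps sum_subtractf)
    qed
    have "A' i k = 0" for i using p by (simp add: A'_def)
    then have "\<forall>j<Suc k. (\<Sum>i\<in>I. d i * A i j) = 0"
      using c(2) by (auto simp: sum_d less_Suc_eq)
    moreover have "\<exists>i\<in>I. d i \<noteq> 0" using c(1) by (auto simp: d_def)
    ultimately show ?thesis by blast
  qed
qed

text \<open>The setting of the direct method: \<open>H\<close> is complete for \<open>E\<close>, and
  \<open>B\<close> is bounded and compact relative to \<open>E\<close>. Compactness asks for
  \<open>B\<close>-Cauchy subsequences, not convergent ones, since \<open>H\<close> need not be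
  complete for \<open>B\<close>.\<close>

locale compact_form = E: semi_inner scale H E + B: semi_inner scale H B
  for scale :: "real \<Rightarrow> 'b::ab_group_add \<Rightarrow> 'b" (infixr "\<cdot>" 75)
    and H :: "'b set" and E B :: "'b \<Rightarrow> 'b \<Rightarrow> real" +
  assumes B_le: "\<exists>C. \<forall>f\<in>H. B f f \<le> C * E f f"
    and compact: "\<And>F. (\<And>n. F n \<in> H) \<Longrightarrow> (\<And>n. E (F n) (F n) \<le> 1) \<Longrightarrow>
      \<exists>r :: nat \<Rightarrow> nat. strict_mono r \<and> (\<forall>\<epsilon>>0. \<exists>N. \<forall>m\<ge>N. \<forall>n\<ge>N.
        B (F (r m) - F (r n)) (F (r m) - F (r n)) < \<epsilon>)"
    and complete: "\<And>F :: nat \<Rightarrow> 'b. (\<And>n. F n \<in> H) \<Longrightarrow>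
      (\<And>\<epsilon>. \<epsilon> > 0 \<Longrightarrow> \<exists>N. \<forall>m\<ge>N. \<forall>n\<ge>N. E (F m - F n) (F m - F n) < \<epsilon>) \<Longrightarrow>
      \<exists>f\<in>H. (\<lambda>n. E (F n - f) (F n - f)) \<longlonglongrightarrow> 0"
begin

lemma B_tendsto:
  assumes F: "\<And>n. F n \<in> H" "f \<in> H" and lim: "(\<lambda>n. E (F n - f) (F n - f)) \<longlonglongrightarrow> 0"
  shows "(\<lambda>n. B (F n - f) (F n - f)) \<longlonglongrightarrow> 0"
proof -
  obtain C where C: "\<And>f. f \<in> H \<Longrightarrow> B f f \<le> C * E f f" using B_le by blast
  have lim': "(\<lambda>n. C * E (F n - f) (F n - f)) \<longlonglongrightarrow> 0"
    using tendsto_mult_left[OF lim, of C] by simp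
  have H: "F n - f \<in> H" for n using F by simp
  have "norm (B (F n - f) (F n - f)) \<le> C * E (F n - f) (F n - f)" for n
    using C[OF H, of n] B.nonneg[OF H, of n] by simp
  then show ?thesis
    by (rule Lim_null_comparison[OF always_eventually[OF allI] lim'])
qed

text \<open>A maximizing sequence for \<open>B\<close> on the \<open>E\<close>-unit ball of
  \<open>Q\<close> has a \<open>B\<close>-Cauchy subsequence, and the parallelogram identities for
  both forms make it \<open>E\<close>-Cauchy, so its limit attains the supremum \<open>s\<close>
  without any weak convergence. The bound \<open>1 \<le> x * s\<close> says that the eigenvalue
  \<open>1 / s\<close> will be at most \<open>x\<close>.\<close>

lemma maximizer:
  fixes e :: "nat \<Rightarrow> 'b"
  assumes e: "\<And>i. i < k \<Longrightarrow> e i \<in> H"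
    and Q_def: "Q = {f\<in>H. \<forall>i<k. E f (e i) = 0}"
    and f0: "f0 \<in> Q" "B f0 f0 > 0" "E f0 f0 \<le> x * B f0 f0"
  shows "\<exists>f s. f \<in> Q \<and> E f f = 1 \<and> B f f = s \<and> s > 0 \<and> 1 \<le> x * s \<and> (\<forall>g\<in>Q. B g g \<le> s * E g g)"
proof -
  note [simp] = e E.mem
  have QI: "f \<in> Q" if "f \<in> H" "\<And>i. i < k \<Longrightarrow> E f (e i) = 0" for f
    using that by (simp add: Q_def)
  have QH: "f \<in> H" and QD: "i < k \<Longrightarrow> E f (e i) = 0" if "f \<in> Q" for f i
    using that by (simp_all add: Q_def)
  have Q_add: "f + g \<in> Q" if "f \<in> Q" "g \<in> Q" for f g
    by (rule QI) (use QH[OF that(1)] QH[OF that(2)] QD[OF that(1)] QD[OF that(2)] in \<open>auto simp: E.bilinear\<close>)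
  have Q_scale: "c \<cdot> f \<in> Q" if "f \<in> Q" for f c
    by (rule QI) (use QH[OF that] QD[OF that] in \<open>auto simp: E.bilinear\<close>)
  note [simp] = QH Q_add Q_scale
  obtain C where C: "\<And>f. f \<in> H \<Longrightarrow> B f f \<le> C * E f f" using B_le by blast
  define S where "S = {B f f | f. f \<in> Q \<and> E f f \<le> 1}"
  have "0 \<in> Q" by (rule QI) (auto simp: E.zero_left)
  then have Sne: "S \<noteq> {}"
    by (auto simp: S_def E.zero_left intro!: exI[of _ 0])
  have "B f f \<le> \<bar>C\<bar>" if "f \<in> Q" "E f f \<le> 1" for f
  proof -
    have "C * E f f \<le> \<bar>C\<bar> * E f f" by (intro mult_right_mono E.nonneg) (use that in auto)
    also have "\<dots> \<le> \<bar>C\<bar> * 1" by (intro mult_left_mono) (use that in auto)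
    finally show ?thesis using C[of f] that by auto
  qed
  then have Sbd: "bdd_above S" by (auto simp: S_def intro!: bdd_aboveI[where M = "\<bar>C\<bar>"])
  define s where "s = Sup S"
  \<comment> \<open>The bound on the unit ball extends by scaling; on \<open>E\<close>-null vectors
    it follows from \<open>B_le\<close>.\<close>
  have homog: "B g g \<le> s * E g g" if g: "g \<in> Q" for g
  proof (cases "E g g = 0")
    case True
    then show ?thesis using C[of g] g by simp
  next
    case False
    then have pos: "E g g > 0" using E.nonneg[of g] g by simp
    have "B ((1 / sqrt (E g g)) \<cdot> g) ((1 / sqrt (E g g)) \<cdot> g) \<in> S"
      unfolding S_def using g pos
      by (intro CollectI exI[of _ "(1 / sqrt (E g g)) \<cdot> g"]) (simp add: E.bilinear)
    then have "B ((1 / sqrt (E g g)) \<cdot> g) ((1 / sqrt (E g g)) \<cdot> g) \<le> s"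
      unfolding s_def by (rule cSup_upper[OF _ Sbd])
    then show ?thesis using g pos by (simp add: B.bilinear field_simps)
  qed
  have E0: "E f0 f0 > 0"
    using C[of f0] f0 E.nonneg[of f0] by (cases "E f0 f0 = 0") auto
  have s0: "s > 0"
    using homog[OF f0(1)] f0(2) E0 by (smt (verit) mult_nonneg_nonneg mult_nonpos_nonneg)
  have "E f0 f0 \<le> x * (s * E f0 f0)"
  proof -
    have "x > 0" using f0(2,3) E0 by (smt (verit) mult_nonpos_nonneg)
    then show ?thesis using homog[OF f0(1)] f0(3) by (smt (verit) mult_left_mono)
  qed
  then have xs: "1 \<le> x * s" using E0 by simp
  have "\<exists>f. f \<in> Q \<and> E f f \<le> 1 \<and> s - 1 / Suc n < B f f" for n
    using less_cSup_iff[OF Sne Sbd, of "s - 1 / Suc n"] by (auto simp: s_def S_def)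
  then obtain F0 where F0: "\<And>n. F0 n \<in> Q" "\<And>n. E (F0 n) (F0 n) \<le> 1"
      "\<And>n. s - 1 / Suc n < B (F0 n) (F0 n)"
    by metis
  obtain r :: "nat \<Rightarrow> nat" where r: "strict_mono r" and
    cau: "\<And>\<epsilon>. \<epsilon> > 0 \<Longrightarrow> \<exists>N. \<forall>m\<ge>N. \<forall>n\<ge>N. B (F0 (r m) - F0 (r n)) (F0 (r m) - F0 (r n)) < \<epsilon>"
    using compact[of F0] F0 by (metis QH)
  define F where "F n = F0 (r n)" for n
  have F: "F n \<in> Q" "E (F n) (F n) \<le> 1" for n using F0 by (auto simp: F_def)
  have Fs: "s - 1 / Suc n < B (F n) (F n)" for n
  proof -
    have "n \<le> r n" using r by (rule strict_mono_imp_increasing)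
    then have "1 / real (Suc (r n)) \<le> 1 / real (Suc n)" by (intro frac_le) auto
    then show ?thesis using F0(3)[of "r n"] by (simp add: F_def)
  qed
  note [simp] = F(1)
  have Ecau: "\<exists>N. \<forall>m\<ge>N. \<forall>n\<ge>N. E (F m - F n) (F m - F n) < \<epsilon>" if "\<epsilon> > 0" for \<epsilon>
  proof -
    have es: "\<epsilon> * s / 2 > 0" using that s0 by simp
    obtain N1 where N1: "\<And>m n. m \<ge> N1 \<Longrightarrow> n \<ge> N1 \<Longrightarrow> B (F m - F n) (F m - F n) < \<epsilon> * s / 2"
      using cau[OF es] by (auto simp: F_def)
    obtain N2 where N2: "1 / Suc N2 < \<epsilon> * s / 8"
      using nat_approx_posE[of "\<epsilon> * s / 8"] es by auto
    show ?thesis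
    proof (intro exI[of _ "max N1 N2"] allI impI)
      fix m n assume mn: "m \<ge> max N1 N2" "n \<ge> max N1 N2"
      have small: "s - \<epsilon> * s / 8 < B (F i) (F i)" if "i \<ge> N2" for i
      proof -
        have "1 / real (Suc i) \<le> 1 / real (Suc N2)" using that by (intro frac_le) auto
        then show ?thesis using Fs[of i] N2 by linarith
      qed
      have par: "E (F m - F n) (F m - F n) = 2 * E (F m) (F m) + 2 * E (F n) (F n) - E (F m + F n) (F m + F n)"
        "B (F m + F n) (F m + F n) = 2 * B (F m) (F m) + 2 * B (F n) (F n) - B (F m - F n) (F m - F n)"
        by (simp_all add: E.bilinear B.bilinear)
      \<comment> \<open>By \<open>homog\<close> and the parallelogram identity the left side is at
        least \<open>2 * B (F m) (F m) + 2 * B (F n) (F n) - B (F m - F n) (F m - F n)\<close>. The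
        losses are four times \<open>\<epsilon> * s / 8\<close> and once
        \<open>\<epsilon> * s / 2\<close>, together \<open>\<epsilon> * s\<close>.\<close>
      have "s * E (F m + F n) (F m + F n) > s * (4 - \<epsilon>)"
        using homog[of "F m + F n"] par(2) small[of m] small[of n] N1[of m n] mn
        by (simp add: algebra_simps)
      then have "E (F m + F n) (F m + F n) > 4 - \<epsilon>" using s0 by simp
      then show "E (F m - F n) (F m - F n) < \<epsilon>" using par(1) F(2)[of m] F(2)[of n] by simp
    qed
  qed
  obtain f where f: "f \<in> H" and lim: "(\<lambda>n. E (F n - f) (F n - f)) \<longlonglongrightarrow> 0"
    using complete[of F] Ecau by auto
  have fQ: "f \<in> Q"
  proof -
    have "E f (e i) = 0" if "i < k" for i
    proof -
      have "(\<lambda>n. E (F n) (e i)) \<longlonglongrightarrow> E f (e i)"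
        by (rule E.tendsto_left) (use f lim that in auto)
      moreover have "E (F n) (e i) = 0" for n using F(1) that by (rule QD)
      ultimately show ?thesis by (simp add: LIMSEQ_const_iff)
    qed
    with f show ?thesis by (intro QI)
  qed
  have "E f f \<le> 1"
    by (rule LIMSEQ_le_const2[OF E.tendsto_norm[OF _ f lim]]) (use F in auto)
  have "(\<lambda>n. B (F n) (F n)) \<longlonglongrightarrow> B f f"
    by (rule B.tendsto_norm[OF _ f B_tendsto[OF _ f lim]]) auto
  moreover have "(\<lambda>n. s - 1 / Suc n) \<longlonglongrightarrow> s - 0"
    by (intro tendsto_intros LIMSEQ_inverse_real_of_nat[unfolded inverse_eq_divide])
  ultimately have "s \<le> B f f"
    using Fs by (intro LIMSEQ_le) (auto intro: less_imp_le)
  then have "s * 1 \<le> s * E f f" using homog[OF fQ] by simp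
  then have "E f f = 1" using s0 \<open>E f f \<le> 1\<close> by simp
  moreover from this have "B f f = s" using \<open>s \<le> B f f\<close> homog[OF fQ] by simp
  ultimately show ?thesis using s0 xs homog fQ by blast
qed

text \<open>The first variation at the maximizer gives the eigenvalue equation against test vectors
  in \<open>Q\<close>. In the directions \<open>e i\<close> both sides vanish because the
  \<open>e i\<close> are eigenvectors, so the equation extends to all of \<open>H\<close>.\<close>

lemma eigenvector_step:
  fixes e :: "nat \<Rightarrow> 'b"
  assumes e: "\<And>i. i < k \<Longrightarrow> e i \<in> H"
    and ortho: "\<And>i j. i < k \<Longrightarrow> j < k \<Longrightarrow> E (e i) (e j) = (if i = j then 1 else 0)"
    and eig: "\<And>i g. i < k \<Longrightarrow> g \<in> H \<Longrightarrow> E (e i) g = l i * B (e i) g"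
    and f0: "f0 \<in> H" "\<And>i. i < k \<Longrightarrow> E f0 (e i) = 0" "B f0 f0 > 0" "E f0 f0 \<le> x * B f0 f0"
  shows "\<exists>f m. f \<in> H \<and> E f f = 1 \<and> (\<forall>i<k. E f (e i) = 0) \<and> m \<le> x \<and> (\<forall>g\<in>H. E f g = m * B f g)"
proof -
  define Q where "Q = {f\<in>H. \<forall>i<k. E f (e i) = 0}"
  have QI: "f \<in> Q" if "f \<in> H" "\<And>i. i < k \<Longrightarrow> E f (e i) = 0" for f
    using that by (simp add: Q_def)
  have QH: "f \<in> H" and QD: "i < k \<Longrightarrow> E f (e i) = 0" if "f \<in> Q" for f i
    using that by (simp_all add: Q_def)
  have "f0 \<in> Q" using f0 by (intro QI)
  from maximizer[OF e Q_def this f0(3,4)]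
  obtain f s where f: "f \<in> Q" "E f f = 1" "B f f = s" "s > 0" "1 \<le> x * s"
    and max: "\<And>g. g \<in> Q \<Longrightarrow> B g g \<le> s * E g g"
    by blast
  note [simp] = e E.mem
  note [simp] = QH
  note [simp] = f(1)
  have Q: "s * E f g = B f g" if g: "g \<in> Q" for g
  proof -
    define d where "d = B f g - s * E f g"
    define D where "D = s * E g g - B g g"
    have ineq: "2 * t * d \<le> t\<^sup>2 * D" for t
    proof -
      have "f + t \<cdot> g \<in> Q"
        by (rule QI) (use g QD[OF g] QD[OF f(1)] in \<open>auto simp: E.bilinear\<close>)
      from max[OF this] show ?thesis
        using g f by (simp add: E.bilinear B.bilinear E.sym[of g f] B.sym[of g f] d_def D_def
            algebra_simps power2_eq_square)
    qed
    have D: "D \<ge> 0" using max[OF g] by (simp add: D_def)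
    \<comment> \<open>Inserting \<open>d = t * (D + 1)\<close> into \<open>ineq\<close> gives
      \<open>t\<^sup>2 * (D + 2) \<le> 0\<close>; the summand 1 covers the case
      \<open>D = 0\<close>.\<close>
    define t where "t = d / (D + 1)"
    have d: "d = t * (D + 1)" using D by (simp add: t_def)
    have "t\<^sup>2 * (D + 2) \<le> 0" using ineq[of t] by (simp add: d algebra_simps power2_eq_square)
    then have "t = 0" using D by (simp add: mult_le_0_iff)
    then have "d = 0" by (simp add: d)
    then show ?thesis by (simp add: d_def)
  qed
  \<comment> \<open>Normalization of \<open>e i\<close> forces \<open>l i \<noteq> 0\<close>, so
    \<open>E\<close>-orthogonality to \<open>e i\<close> implies
    \<open>B\<close>-orthogonality.\<close>
  have Be: "B f (e i) = 0 \<and> E f (e i) = 0" if i: "i < k" for i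
  proof -
    have "E f (e i) = 0" using f(1) i by (rule QD)
    moreover from this have "l i * B (e i) f = 0" "l i * B (e i) (e i) = 1"
      using eig[OF i, of f] eig[OF i, of "e i"] ortho[OF i i] i by (auto simp: E.sym[of f "e i"])
    ultimately show ?thesis using i by (auto simp: B.sym[of f "e i"])
  qed
  have all: "s * E f g = B f g" if g: "g \<in> H" for g
  proof -
    \<comment> \<open>The \<open>E\<close>-orthogonal projection of \<open>g\<close> onto the span
      of the \<open>e i\<close>; the remainder \<open>g - p\<close> lies in
      \<open>Q\<close>.\<close>
    define p where "p = (\<Sum>i<k. E g (e i) \<cdot> e i)"
    have p: "p \<in> H" unfolding p_def by (intro E.mem) auto
    have "E p (e j) = E g (e j)" if j: "j < k" for j
    proof -
      have "E p (e j) = (\<Sum>i<k. E (E g (e i) \<cdot> e i) (e j))"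
        unfolding p_def by (intro E.sum_left) (use j in auto)
      also have "\<dots> = (\<Sum>i<k. if j = i then E g (e i) else 0)"
        by (intro sum.cong) (use j ortho in \<open>auto simp: E.scale_left\<close>)
      finally show ?thesis using j by simp
    qed
    then have "g - p \<in> Q" using g p by (intro QI) (auto simp: E.diff_left)
    moreover have "E f p = 0" "B f p = 0"
      unfolding p_def
      by (subst E.sum_right B.sum_right; use Be in \<open>auto simp: E.scale_right B.scale_right\<close>)+
    ultimately show ?thesis using Q[of "g - p"] g p by (simp add: E.diff_right B.diff_right)
  qed
  show ?thesis
  proof (intro exI[of _ f] exI[of _ "1 / s"] conjI)
    show "1 / s \<le> x" using f by (simp add: field_simps)
    show "\<forall>g\<in>H. E f g = 1 / s * B f g" using all f(4) by (auto simp: field_simps)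
  qed (use Be f in auto)
qed

text \<open>The lower half of the min-max principle: an \<open>m\<close>-dimensional space on which
  the Rayleigh quotient is at most \<open>x\<close> yields \<open>m\<close> orthonormal eigenvectors
  with eigenvalues at most \<open>x\<close>. As long as \<open>k < m\<close>, that space contains a
  nonzero vector orthogonal to the \<open>k\<close> eigenvectors already found, and this vector
  starts the next maximization.\<close>

theorem eigenvectors:
  assumes I: "finite I" "card I = m"
    and v: "\<And>i. i \<in> I \<Longrightarrow> v i \<in> H"
    and V: "\<And>c. \<exists>i\<in>I. c i \<noteq> 0 \<Longrightarrow> B (\<Sum>i\<in>I. c i \<cdot> v i) (\<Sum>i\<in>I. c i \<cdot> v i) > 0 \<and>
      E (\<Sum>i\<in>I. c i \<cdot> v i) (\<Sum>i\<in>I. c i \<cdot> v i) \<le> x * B (\<Sum>i\<in>I. c i \<cdot> v i) (\<Sum>i\<in>I. c i \<cdot> v i)"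
  shows "\<exists>(e :: nat \<Rightarrow> 'b) l. \<forall>i<m. e i \<in> H \<and> l i \<le> x \<and> (\<forall>j<m. E (e i) (e j) = (if i = j then 1 else 0)) \<and>
    (\<forall>g\<in>H. E (e i) g = l i * B (e i) g)"
proof -
  note [simp] = E.mem
  have "k \<le> m \<Longrightarrow> \<exists>(e :: nat \<Rightarrow> 'b) l. \<forall>i<k. e i \<in> H \<and> l i \<le> x \<and>
      (\<forall>j<k. E (e i) (e j) = (if i = j then 1 else 0)) \<and> (\<forall>g\<in>H. E (e i) g = l i * B (e i) g)" for k
  proof (induction k)
    case (Suc k)
    then obtain e l where *: "\<forall>i<k. e i \<in> H \<and> l i \<le> x \<and>
      (\<forall>j<k. E (e i) (e j) = (if i = j then 1 else 0)) \<and> (\<forall>g\<in>H. E (e i) g = l i * B (e i) g)"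
      by auto
    have el: "e i \<in> H" "l i \<le> x" if "i < k" for i
      using * that by simp_all
    have ortho: "E (e i) (e j) = (if i = j then 1 else 0)" if "i < k" "j < k" for i j
      using *[THEN spec, THEN mp, OF that(1), THEN conjunct2, THEN conjunct2, THEN conjunct1] that(2)
      by simp
    have eig: "E (e i) g = l i * B (e i) g" if "i < k" "g \<in> H" for i g
      using * that by simp
    obtain c where c: "\<exists>i\<in>I. c i \<noteq> 0" "\<And>j. j < k \<Longrightarrow> (\<Sum>i\<in>I. c i * E (v i) (e j)) = 0"
      using nontrivial_kernel[of I k "\<lambda>i j. E (v i) (e j)"] I Suc.prems by auto
    define f0 where "f0 = (\<Sum>i\<in>I. c i \<cdot> v i)"
    have f0: "f0 \<in> H" unfolding f0_def by (intro E.mem) (use v in auto)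
    have "E f0 (e j) = 0" if j: "j < k" for j
    proof -
      have "E f0 (e j) = (\<Sum>i\<in>I. E (c i \<cdot> v i) (e j))"
        unfolding f0_def by (intro E.sum_left) (use v j el in auto)
      also have "\<dots> = (\<Sum>i\<in>I. c i * E (v i) (e j))"
        by (intro sum.cong) (use v j el in \<open>auto simp: E.scale_left\<close>)
      finally show ?thesis using c j by simp
    qed
    with V[OF c(1)] obtain f \<mu> where f: "f \<in> H" "E f f = 1" "\<And>i. i < k \<Longrightarrow> E f (e i) = 0" "\<mu> \<le> x"
        "\<And>g. g \<in> H \<Longrightarrow> E f g = \<mu> * B f g"
      using eigenvector_step[where x = x, OF el(1) ortho eig f0] unfolding f0_def by blast
    have f': "E (e i) f = 0" if "i < k" for i
      using f(3)[OF that] E.sym[OF f(1) el(1)[OF that]] by simp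
    show ?case
    proof (intro exI[of _ "e(k := f)"] exI[of _ "l(k := \<mu>)"] allI impI conjI ballI)
      fix i assume i: "i < Suc k"
      show "(e(k := f)) i \<in> H" "(l(k := \<mu>)) i \<le> x" using i el f by (auto simp: less_Suc_eq)
      show "E ((e(k := f)) i) ((e(k := f)) j) = (if i = j then 1 else 0)" if "j < Suc k" for j
        using i that f f' ortho by (auto simp: less_Suc_eq)
      show "E ((e(k := f)) i) g = (l(k := \<mu>)) i * B ((e(k := f)) i) g" if "g \<in> H" for g
        using i that f eig by (auto simp: less_Suc_eq)
    qed
  qed simp
  then show ?thesis by blast
qed

end

section \<open>Square integrable representatives, their inner product and the Riesz-Fischer
  theorem\<close>

section \<open>Square integrable functions\<close>

definition square_integrable :: "'a measure \<Rightarrow> ('a \<Rightarrow> real) \<Rightarrow> bool" where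
  "square_integrable M f \<longleftrightarrow> f \<in> borel_measurable M \<and> integrable M (\<lambda>x. (f x)\<^sup>2)"

lemma square_integrable_measurable [measurable_dest]:
  "square_integrable M f \<Longrightarrow> f \<in> borel_measurable M"
  by (simp add: square_integrable_def)

lemma square_integrable_mult:
  assumes f: "square_integrable M f" and g: "square_integrable M g"
  shows "integrable M (\<lambda>x. f x * g x)"
proof (rule Bochner_Integration.integrable_bound)
  show "integrable M (\<lambda>x. (f x)\<^sup>2 + (g x)\<^sup>2)"
    using f g by (auto simp: square_integrable_def)
  show "(\<lambda>x. f x * g x) \<in> borel_measurable M"
    using f g by (auto simp: square_integrable_def)
  show "AE x in M. norm (f x * g x) \<le> norm ((f x)\<^sup>2 + (g x)\<^sup>2)"
  proof (intro AE_I2)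
    fix x
    have "0 \<le> (\<bar>f x\<bar> - \<bar>g x\<bar>)\<^sup>2" "0 \<le> \<bar>f x\<bar> * \<bar>g x\<bar>" by simp_all
    then have "\<bar>f x\<bar> * \<bar>g x\<bar> \<le> (f x)\<^sup>2 + (g x)\<^sup>2"
      unfolding power2_diff power2_abs by linarith
    then show "norm (f x * g x) \<le> norm ((f x)\<^sup>2 + (g x)\<^sup>2)"
      by (simp add: abs_mult)
  qed
qed

lemma square_integrable_add:
  assumes "square_integrable M f" "square_integrable M g"
  shows "square_integrable M (\<lambda>x. f x + g x)"
proof -
  have "integrable M (\<lambda>x. (f x)\<^sup>2 + (g x)\<^sup>2 + 2 * (f x * g x))"
    using assms square_integrable_mult[OF assms] by (auto simp: square_integrable_def)
  moreover have "(\<lambda>x. (f x)\<^sup>2 + (g x)\<^sup>2 + 2 * (f x * g x)) = (\<lambda>x. (f x + g x)\<^sup>2)"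
    by (simp add: fun_eq_iff power2_sum)
  ultimately show ?thesis using assms by (auto simp: square_integrable_def)
qed

lemma square_integrable_cmult:
  "square_integrable M f \<Longrightarrow> square_integrable M (\<lambda>x. c * f x)"
  by (auto simp: square_integrable_def power_mult_distrib)

lemma square_integrable_diff:
  "square_integrable M f \<Longrightarrow> square_integrable M g \<Longrightarrow> square_integrable M (\<lambda>x. f x - g x)"
  using square_integrable_add[of M f "\<lambda>x. -1 * g x"] square_integrable_cmult[of M g "-1"] by simp

lemma (in finite_measure) square_integrable_bounded:
  assumes f: "f \<in> borel_measurable M" and "\<And>x. x \<in> space M \<Longrightarrow> \<bar>f x\<bar> \<le> C"
  shows "square_integrable M f"
  unfolding square_integrable_def
proof
  have "(f x)\<^sup>2 \<le> C\<^sup>2" if "x \<in> space M" for x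
    using power_mono[OF assms(2)[OF that], of 2] by simp
  then show "integrable M (\<lambda>x. (f x)\<^sup>2)"
    by (intro integrable_const_bound[of _ "C\<^sup>2"]) (use f in auto)
qed (rule f)

lemma (in finite_measure) square_integrable_integrable:
  assumes "square_integrable M f"
  shows "integrable M f"
  using square_integrable_mult[OF assms square_integrable_bounded[of "\<lambda>_. 1" 1]] by simp

lemma semi_inner_square_integrable:
  fixes M :: "real measure"
  shows "semi_inner (\<lambda>c f x. c * f x) {f. square_integrable M f} (\<lambda>f g. \<integral>x. f x * g x \<partial>M)"
proof
  show "fun_space.subspace {f. square_integrable M f}"
    unfolding fun_space.subspace_def
    by (auto simp: square_integrable_add square_integrable_cmult plus_fun_def zero_fun_def)
       (simp add: square_integrable_def)
qed (auto simp: square_integrable_mult plus_fun_def algebra_simps power2_eq_square[symmetric])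

text \<open>A fast subsequence converges almost everywhere, and Fatou's lemma shows that its
  pointwise limit is the limit of the whole sequence in mean square.\<close>

theorem square_integrable_complete:
  fixes F :: "nat \<Rightarrow> 'a \<Rightarrow> real"
  assumes F: "\<And>n. square_integrable M (F n)"
    and cauchy: "\<And>\<epsilon>. \<epsilon> > 0 \<Longrightarrow> \<exists>N. \<forall>m\<ge>N. \<forall>n\<ge>N. (\<integral>x. (F m x - F n x)\<^sup>2 \<partial>M) < \<epsilon>"
  shows "\<exists>g. square_integrable M g \<and> (\<lambda>n. \<integral>x. (F n x - g x)\<^sup>2 \<partial>M) \<longlonglongrightarrow> 0"
proof -
  have [measurable]: "F n \<in> borel_measurable M" for n using F[of n] by (simp add: square_integrable_def)
  have int: "integrable M (\<lambda>x. (F m x - F n x)\<^sup>2)" for m n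
    using square_integrable_diff[OF F F, of m n] by (simp add: square_integrable_def)
  \<comment> \<open>The rate 1/8 leaves a summable \<open>(1 / 2) ^ k\<close> after weighting with
    \<open>4 ^ k\<close>; finiteness of the weighted sum at \<open>x\<close> then gives
    \<open>\<bar>d k x\<bar> \<le> sqrt C * (1 / 2) ^ k\<close>.\<close>
  have "\<exists>N. \<forall>m\<ge>N. \<forall>n\<ge>N. (\<integral>x. (F m x - F n x)\<^sup>2 \<partial>M) < (1 / 8) ^ k" for k
    by (rule cauchy) simp
  then obtain N where N: "\<And>k m n. m \<ge> N k \<Longrightarrow> n \<ge> N k \<Longrightarrow> (\<integral>x. (F m x - F n x)\<^sup>2 \<partial>M) < (1 / 8) ^ k"
    by metis
  \<comment> \<open>Partial sums make the index sequence monotone while keeping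
    \<open>N k \<le> r k\<close>.\<close>
  define r where "r k = (\<Sum>i\<le>k. N i)" for k
  have r_mono: "r j \<le> r k" if "j \<le> k" for j k
    unfolding r_def by (rule sum_mono2) (use that in auto)
  have r: "(\<integral>x. (F m x - F n x)\<^sup>2 \<partial>M) < (1 / 8) ^ k" if "m \<ge> r k" "n \<ge> r k" for k m n
  proof (rule N)
    have "N k \<le> r k" unfolding r_def by (rule member_le_sum) auto
    then show "m \<ge> N k" "n \<ge> N k" using that by auto
  qed
  define d where "d k x = F (r (Suc k)) x - F (r k) x" for k x
  have [measurable]: "d k \<in> borel_measurable M" for k unfolding d_def by measurable
  have "(\<integral>\<^sup>+x. (\<Sum>k. ennreal (4 ^ k * (d k x)\<^sup>2)) \<partial>M) = (\<Sum>k. \<integral>\<^sup>+x. ennreal (4 ^ k * (d k x)\<^sup>2) \<partial>M)"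
    by (intro nn_integral_suminf) measurable
  also have "\<dots> \<le> (\<Sum>k. ennreal ((1 / 2) ^ k))"
  proof (intro suminf_le summableI)
    fix k
    have "(\<integral>\<^sup>+x. ennreal (4 ^ k * (d k x)\<^sup>2) \<partial>M) = ennreal (\<integral>x. 4 ^ k * (d k x)\<^sup>2 \<partial>M)"
      by (intro nn_integral_eq_integral) (auto simp: d_def int)
    also have "(\<integral>x. 4 ^ k * (d k x)\<^sup>2 \<partial>M) \<le> 4 ^ k * (1 / 8) ^ k"
      using r[of k "r (Suc k)" "r k"] r_mono[of k "Suc k"] by (simp add: d_def less_imp_le)
    also have "\<dots> = (1 / 2) ^ k" by (simp flip: power_mult_distrib)
    finally show "(\<integral>\<^sup>+x. ennreal (4 ^ k * (d k x)\<^sup>2) \<partial>M) \<le> ennreal ((1 / 2) ^ k)"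
      by (simp add: ennreal_leI)
  qed
  also have "\<dots> = ennreal (\<Sum>k. (1 / 2) ^ k)"
    by (intro suminf_ennreal_eq) (auto intro: summable_sums summable_geometric)
  also have "\<dots> < \<infinity>" by simp
  finally have "(\<integral>\<^sup>+x. (\<Sum>k. ennreal (4 ^ k * (d k x)\<^sup>2)) \<partial>M) \<noteq> \<infinity>" by simp
  then have "AE x in M. (\<Sum>k. ennreal (4 ^ k * (d k x)\<^sup>2)) \<noteq> \<infinity>"
    by (intro nn_integral_PInf_AE) measurable
  then have conv: "AE x in M. convergent (\<lambda>k. F (r k) x)"
  proof eventually_elim
    case (elim x)
    define C where "C = enn2real (\<Sum>k. ennreal (4 ^ k * (d k x)\<^sup>2))"
    have C0: "C \<ge> 0" by (simp add: C_def)
    have "norm (d k x) \<le> sqrt C * (1 / 2) ^ k" for k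
    proof -
      define u where "u k = ennreal (4 ^ k * (d k x)\<^sup>2)" for k
      have "ennreal (4 ^ k * (d k x)\<^sup>2) = u k" by (simp add: u_def)
      also have "u k \<le> (\<Sum>k. u k)" using sum_le_suminf[of u "{k}"] by simp
      also have "\<dots> = ennreal C"
        using elim by (simp only: C_def u_def less_top infinity_ennreal_def ennreal_enn2real)
      finally have "4 ^ k * (d k x)\<^sup>2 \<le> C"
        using C0 by (simp only: ennreal_le_iff)
      then have "sqrt (4 ^ k * (d k x)\<^sup>2) \<le> sqrt C" by simp
      then have "2 ^ k * \<bar>d k x\<bar> \<le> sqrt C"
        by (simp add: real_sqrt_mult real_sqrt_power[of 4 k])
      then show ?thesis by (simp add: power_one_over field_simps)
    qed
    then have "summable (\<lambda>k. d k x)"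
      by (intro summable_comparison_test'[OF summable_mult[OF summable_geometric]]) auto
    then have "convergent (\<lambda>n. (\<Sum>k<n. d k x) + F (r 0) x)"
      by (intro convergent_add convergent_const) (simp add: summable_iff_convergent)
    moreover have "(\<Sum>k<n. d k x) + F (r 0) x = F (r n) x" for n
      unfolding d_def by (subst sum_lessThan_telescope) simp
    ultimately show ?case by simp
  qed
  define g where "g x = lim (\<lambda>k. F (r k) x)" for x
  have [measurable]: "g \<in> borel_measurable M" unfolding g_def by measurable
  have fatou: "(\<integral>\<^sup>+x. ennreal ((F n x - g x)\<^sup>2) \<partial>M) \<le> ennreal ((1 / 8) ^ K)" if n: "n \<ge> r K" for n K
  proof -
    have "AE x in M. ennreal ((F n x - g x)\<^sup>2) = liminf (\<lambda>k. ennreal ((F n x - F (r k) x)\<^sup>2))"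
      using conv
    proof eventually_elim
      case (elim x)
      then have "(\<lambda>k. F (r k) x) \<longlonglongrightarrow> g x" by (simp add: g_def convergent_LIMSEQ_iff)
      then have "(\<lambda>k. ennreal ((F n x - F (r k) x)\<^sup>2)) \<longlonglongrightarrow> ennreal ((F n x - g x)\<^sup>2)"
        by (intro tendsto_intros)
      then show ?case by (intro lim_imp_Liminf[symmetric]) auto
    qed
    then have "(\<integral>\<^sup>+x. ennreal ((F n x - g x)\<^sup>2) \<partial>M) =
        (\<integral>\<^sup>+x. liminf (\<lambda>k. ennreal ((F n x - F (r k) x)\<^sup>2)) \<partial>M)"
      by (rule nn_integral_cong_AE)
    also have "\<dots> \<le> liminf (\<lambda>k. \<integral>\<^sup>+x. ennreal ((F n x - F (r k) x)\<^sup>2) \<partial>M)"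
      by (intro nn_integral_liminf) measurable
    also have "\<dots> \<le> ennreal ((1 / 8) ^ K)"
    proof (rule Liminf_le)
      show "\<forall>\<^sub>F k in sequentially. (\<integral>\<^sup>+x. ennreal ((F n x - F (r k) x)\<^sup>2) \<partial>M) \<le> ennreal ((1 / 8) ^ K)"
        using eventually_ge_at_top[of K]
      proof eventually_elim
        case (elim k)
        have "(\<integral>\<^sup>+x. ennreal ((F n x - F (r k) x)\<^sup>2) \<partial>M) = ennreal (\<integral>x. (F n x - F (r k) x)\<^sup>2 \<partial>M)"
          by (intro nn_integral_eq_integral int) auto
        also have "\<dots> \<le> ennreal ((1 / 8) ^ K)"
          using r[OF n r_mono[OF elim]] by (intro ennreal_leI) simp
        finally show ?case .
      qed
    qed simp
    finally show ?thesis .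
  qed
  have int_g: "integrable M (\<lambda>x. (F n x - g x)\<^sup>2)" if "n \<ge> r K" for n K
    using fatou[OF that] by (intro integrableI_bounded) (auto intro: le_less_trans)
  have "square_integrable M (\<lambda>x. F (r 0) x - (F (r 0) x - g x))"
    by (rule square_integrable_diff[OF F]) (use int_g[of 0 "r 0"] in \<open>auto simp: square_integrable_def\<close>)
  then have g: "square_integrable M g" by simp
  have "(\<lambda>n. \<integral>x. (F n x - g x)\<^sup>2 \<partial>M) \<longlonglongrightarrow> 0"
  proof (rule LIMSEQ_I)
    fix \<epsilon> :: real assume "\<epsilon> > 0"
    then obtain K where K: "(1 / 8) ^ K < \<epsilon>" using real_arch_pow_inv[of \<epsilon> "1 / 8"] by auto
    show "\<exists>n0. \<forall>n\<ge>n0. norm ((\<integral>x. (F n x - g x)\<^sup>2 \<partial>M) - 0) < \<epsilon>"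
    proof (intro exI[of _ "r K"] allI impI)
      fix n assume n: "n \<ge> r K"
      have "ennreal (\<integral>x. (F n x - g x)\<^sup>2 \<partial>M) = (\<integral>\<^sup>+x. ennreal ((F n x - g x)\<^sup>2) \<partial>M)"
        by (intro nn_integral_eq_integral[symmetric] int_g[OF n]) auto
      also have "\<dots> \<le> ennreal ((1 / 8) ^ K)" by (rule fatou[OF n])
      finally have "(\<integral>x. (F n x - g x)\<^sup>2 \<partial>M) \<le> (1 / 8) ^ K" by simp
      then show "norm ((\<integral>x. (F n x - g x)\<^sup>2 \<partial>M) - 0) < \<epsilon>" using K by simp
    qed
  qed
  with g show ?thesis by blast
qed

section \<open>Primitives of square integrable functions: increments, Hoelder bound and uniqueness
  of the gradient\<close>

section \<open>Weak gradients\<close>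

definition lborel01 :: "real measure" where
  "lborel01 = restrict_space lborel {0..1}"

lemma space_lborel01 [simp]: "space lborel01 = {0..1}"
  by (simp add: lborel01_def space_restrict_space)

lemma borel_measurable_lborel01: "f \<in> borel_measurable borel \<Longrightarrow> f \<in> borel_measurable lborel01"
  unfolding lborel01_def by (intro measurable_restrict_space1) simp

lemma integral_lborel01: "(\<integral>x. f x \<partial>lborel01) = (\<integral>x. indicator {0..1} x * f x \<partial>lborel)"
  for f :: "real \<Rightarrow> real"
  by (simp add: lborel01_def integral_restrict_space)

interpretation lborel01: finite_measure lborel01
  by standard (simp add: lborel01_def emeasure_restrict_space space_restrict_space)

lemma AE_lborel01: "AE x in lborel. x \<in> {0..1} \<longrightarrow> P x \<Longrightarrow> AE x in lborel01. P x"
  unfolding lborel01_def by (subst AE_restrict_space_iff) auto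

lemma integral_indicator_lborel01:
  assumes "0 \<le> a" "a \<le> b" "b \<le> 1"
  shows "(\<integral>x. indicator {a<..b} x \<partial>lborel01) = b - a"
proof -
  have "(\<integral>x. indicator {a<..b} x \<partial>lborel01) = (\<integral>x. indicat_real {a<..b} x \<partial>lborel)"
    unfolding integral_lborel01
    by (intro Bochner_Integration.integral_cong) (use assms in \<open>auto simp: indicator_def\<close>)
  then show ?thesis using assms by simp
qed

lemma square_integrable_indicator:
  "A \<in> sets borel \<Longrightarrow> square_integrable lborel01 (indicator A)"
  by (rule lborel01.square_integrable_bounded[of _ 1])
     (auto intro!: borel_measurable_lborel01 simp: indicator_def)

text \<open>Moves the set integrals over subsets of the unit interval to the finite measure
  \<open>lborel01\<close>, where the results on square integrable functions apply.\<close>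

lemma has_L2_gradient_iff:
  "has_L2_gradient f g \<longleftrightarrow> square_integrable lborel01 g \<and>
    (\<forall>x\<in>{0..1}. f x = (\<integral>t. indicator {0..x} t * g t \<partial>lborel01))"
proof -
  have "(\<integral>t. indicator {0..x} t * g t \<partial>lborel01) = (LINT t:{0..x}|lborel. g t)" if "x \<in> {0..1}" for x
    unfolding integral_lborel01 set_lebesgue_integral_def
    by (intro Bochner_Integration.integral_cong) (use that in \<open>auto simp: indicator_def\<close>)
  then show ?thesis
    by (simp add: has_L2_gradient_def square_integrable_def lborel01_def set_borel_measurable_def
        set_integrable_def borel_measurable_restrict_space_iff integrable_restrict_space)
qed

lemma square_integrable_gradient: "has_L2_gradient f g \<Longrightarrow> square_integrable lborel01 g"
  by (simp add: has_L2_gradient_iff)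

lemma gradient_increment:
  assumes f: "has_L2_gradient f g" and "0 \<le> a" "a \<le> b" "b \<le> 1"
  shows "(\<integral>t. indicator {a<..b} t * g t \<partial>lborel01) = f b - f a"
proof -
  have int: "integrable lborel01 (\<lambda>t. indicator {0..x} t * g t)" for x
    by (intro square_integrable_mult square_integrable_indicator square_integrable_gradient[OF f]) auto
  have "indicator {a<..b} t = indicator {0..b} t - (indicator {0..a} t :: real)" for t
    using assms by (auto simp: indicator_def)
  then have "(\<integral>t. indicator {a<..b} t * g t \<partial>lborel01) =
      (\<integral>t. indicator {0..b} t * g t - indicator {0..a} t * g t \<partial>lborel01)"
    by (simp add: left_diff_distrib)
  also have "\<dots> = (\<integral>t. indicator {0..b} t * g t \<partial>lborel01) - (\<integral>t. indicator {0..a} t * g t \<partial>lborel01)"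
    by (intro Bochner_Integration.integral_diff int)
  also have "\<dots> = f b - f a"
    using assms by (simp add: has_L2_gradient_iff)
  finally show ?thesis .
qed

text \<open>Cauchy-Schwarz for the gradient against the indicator of \<open>{a<..b}\<close>; this is
  Hoelder continuity with exponent 1/2.\<close>

lemma gradient_holder:
  assumes f: "has_L2_gradient f g" and "0 \<le> a" "a \<le> b" "b \<le> 1"
  shows "(f b - f a)\<^sup>2 \<le> (b - a) * (\<integral>x. g x * g x \<partial>lborel01)"
proof -
  interpret L2: semi_inner "\<lambda>c f x. c * f x" "{f. square_integrable lborel01 f}" "\<lambda>f g. \<integral>x. f x * g x \<partial>lborel01"
    by (rule semi_inner_square_integrable)
  have "(\<integral>x. indicator {a<..b} x * indicator {a<..b} x \<partial>lborel01) = b - a"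
    using integral_indicator_lborel01[OF assms(2-4)] by (simp only: indicator_inter_arith[symmetric] Int_absorb)
  then show ?thesis
    using L2.cauchy_schwarz[of "indicator {a<..b}" g] gradient_increment[OF assms]
      square_integrable_gradient[OF f] square_integrable_indicator[of "{a<..b}"] by simp
qed

text \<open>The initial segments generate the Borel sets and are closed under intersection, so the
  integral of the extension \<open>D\<close> by zero vanishes over every Borel set.\<close>

lemma AE_zero_if_integrals_zero:
  assumes d: "square_integrable lborel01 d"
    and zero: "\<And>x. x \<in> {0..1} \<Longrightarrow> (\<integral>t. indicator {0..x} t * d t \<partial>lborel01) = 0"
  shows "AE x in lborel01. d x = 0"
proof -
  define D where "D x = indicator {0..1} x * d x" for x :: real
  have intD: "integrable lborel D"
    using lborel01.square_integrable_integrable[OF d]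
    by (simp add: lborel01_def integrable_restrict_space D_def[abs_def])
  have initial: "set_lebesgue_integral lborel {..x} D = 0" for x
  proof (cases "x < 0")
    case True
    then have "indicator {..x} t *\<^sub>R D t = 0" for t by (auto simp: D_def indicator_def)
    then show ?thesis unfolding set_lebesgue_integral_def by (simp only: integral_zero)
  next
    case False
    have "indicator {..x} t *\<^sub>R D t = indicator {0..1} t * (indicator {0..min x 1} t * d t)" for t
      by (auto simp: D_def indicator_def)
    then show ?thesis
      using zero[of "min x 1"] False by (simp add: set_lebesgue_integral_def integral_lborel01)
  qed
  have all: "set_lebesgue_integral lborel A D = 0" if "A \<in> sets borel" for A
  proof -
    have "A \<in> sigma_sets UNIV (range atMost)"
      using that by (simp add: borel_eq_atMost)
    have borel: "sigma_sets UNIV (range atMost) = sets (borel :: real measure)"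
      by (simp add: borel_eq_atMost)
    have Int_st: "Int_stable (range (atMost :: real \<Rightarrow> real set))"
      by (auto simp: Int_stable_def)
    have sint: "set_integrable lborel B D" if "B \<in> sets borel" for B
      unfolding set_integrable_def using that intD by (intro integrable_mult_indicator) auto
    \<comment> \<open>Needed for complements in the induction; \<open>D\<close> vanishes beyond 1,
      so the segment up to 1 already gives the whole integral.\<close>
    have UNIV: "set_lebesgue_integral lborel UNIV D = 0"
    proof -
      have "set_lebesgue_integral lborel UNIV D = set_lebesgue_integral lborel {..1} D"
        unfolding set_lebesgue_integral_def
        by (intro Bochner_Integration.integral_cong) (auto simp: D_def indicator_def)
      then show ?thesis using initial by simp
    qed
    have sub: "range (atMost :: real \<Rightarrow> real set) \<subseteq> Pow UNIV" by simp
    from Int_st sub \<open>A \<in> sigma_sets UNIV (range atMost)\<close> show ?thesis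
    proof (induction rule: sigma_sets_induct_disjoint)
      case (compl B)
      then have B: "B \<in> sets borel" by (simp add: borel)
      have "set_lebesgue_integral lborel (B \<union> (UNIV - B)) D =
          set_lebesgue_integral lborel B D + set_lebesgue_integral lborel (UNIV - B) D"
        by (intro set_integral_Un sint) (use B in auto)
      then show ?case using compl UNIV by simp
    next
      case (union B)
      have B: "B i \<in> sets borel" for i using union by (auto simp: borel)
      have "set_lebesgue_integral lborel (\<Union>i. B i) D = (\<Sum>i. set_lebesgue_integral lborel (B i) D)"
        by (rule lebesgue_integral_countable_add)
           (use union B in \<open>auto simp: disjoint_family_on_def intro!: sint\<close>)
      then show ?case using union by simp
    qed (use initial in \<open>auto simp: set_lebesgue_integral_def\<close>)
  qed
  have "AE x in lborel. D x = 0"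
    by (rule sigma_finite_measure.density_zero[OF sigma_finite_lborel intD]) (simp add: all)
  then have "AE x in lborel. x \<in> {0..1} \<longrightarrow> d x = 0"
    by eventually_elim (auto simp: D_def)
  then show ?thesis by (rule AE_lborel01)
qed

lemma gradient_unique:
  assumes "has_L2_gradient f g" "has_L2_gradient f h"
  shows "AE x in lborel01. g x = h x"
proof -
  note sq = square_integrable_gradient[OF assms(1)] square_integrable_gradient[OF assms(2)]
  have "AE x in lborel01. g x - h x = 0"
  proof (rule AE_zero_if_integrals_zero)
    fix x :: real assume x: "x \<in> {0..1}"
    have "(\<integral>t. indicator {0..x} t * (g t - h t) \<partial>lborel01) =
      (\<integral>t. indicator {0..x} t * g t \<partial>lborel01) - (\<integral>t. indicator {0..x} t * h t \<partial>lborel01)"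
      unfolding right_diff_distrib
      by (intro Bochner_Integration.integral_diff square_integrable_mult square_integrable_indicator sq) auto
    then show "(\<integral>t. indicator {0..x} t * (g t - h t) \<partial>lborel01) = 0"
      using assms x by (simp add: has_L2_gradient_iff)
  qed (intro square_integrable_diff sq)
  then show ?thesis by simp
qed

text \<open>Frees the form from the gradients selected by \<open>SOME\<close>: gradients are unique
  almost everywhere, and the endpoints missing from the open interval are a null set.\<close>

lemma E_form_eq:
  assumes "has_L2_gradient f F" "has_L2_gradient g G"
  shows "E_form f g = (\<integral>x. F x * G x \<partial>lborel01)"
proof -
  have grad: "has_L2_gradient f (gradient f)" "has_L2_gradient g (gradient g)"
    unfolding gradient_def using assms someI[of "has_L2_gradient f" F] someI[of "has_L2_gradient g" G] by simp_all
  note sq [THEN square_integrable_measurable, measurable] =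
    square_integrable_gradient[OF assms(1)] square_integrable_gradient[OF assms(2)]
    square_integrable_gradient[OF grad(1)] square_integrable_gradient[OF grad(2)]
  \<comment> \<open>A selected gradient is known to be measurable only on the unit interval, hence
    the indicator.\<close>
  have m: "(\<lambda>x. indicator {0..1} x * (gradient f x * gradient g x)) \<in> borel_measurable lborel"
  proof -
    have "(\<lambda>x. gradient f x * gradient g x) \<in> borel_measurable lborel01" by measurable
    then show ?thesis by (simp add: lborel01_def borel_measurable_restrict_space_iff)
  qed
  have eq: "AE x in lborel. indicator {0<..<1} x *\<^sub>R (gradient f x * gradient g x) =
      indicator {0..1} x * (gradient f x * gradient g x)"
    using AE_lborel_singleton[of 0] AE_lborel_singleton[of 1]
    by eventually_elim (auto simp: indicator_def)
  have "E_form f g = (\<integral>x. gradient f x * gradient g x \<partial>lborel01)"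
    unfolding E_form_def set_lebesgue_integral_def integral_lborel01
  proof (rule integral_cong_AE)
    have "(\<lambda>x. indicator {0<..<1} x * (indicator {0..1} x * (gradient f x * gradient g x)))
        \<in> borel_measurable lborel"
      using m by measurable
    moreover have "(\<lambda>x. indicator {0<..<1} x * (indicator {0..1} x * (gradient f x * gradient g x))) =
        (\<lambda>x. indicator {0<..<1} x *\<^sub>R (gradient f x * gradient g x))"
      by (auto simp: indicator_def fun_eq_iff)
    ultimately show "(\<lambda>x. indicator {0<..<1} x *\<^sub>R (gradient f x * gradient g x)) \<in> borel_measurable lborel"
      by simp
  qed (use m eq in auto)
  also have "\<dots> = (\<integral>x. F x * G x \<partial>lborel01)"
  proof (rule integral_cong_AE)
    show "AE x in lborel01. gradient f x * gradient g x = F x * G x"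
      using gradient_unique[OF grad(1) assms(1)] gradient_unique[OF grad(2) assms(2)]
      by eventually_elim simp
  qed measurable
  finally show ?thesis .
qed

section \<open>Energy form on \<open>H10\<close>, completeness, and pairing with piecewise linear
  hats\<close>

section \<open>The Sobolev space and tents\<close>

lemma has_L2_gradient_add:
  assumes "has_L2_gradient f F" "has_L2_gradient g G"
  shows "has_L2_gradient (f + g) (\<lambda>x. F x + G x)"
proof -
  note sq = square_integrable_gradient[OF assms(1)] square_integrable_gradient[OF assms(2)]
  have "integrable lborel01 (\<lambda>t. indicator {0..x} t * F t)" "integrable lborel01 (\<lambda>t. indicator {0..x} t * G t)" for x
    by (intro square_integrable_mult square_integrable_indicator sq; simp)+
  then show ?thesis
    using assms square_integrable_add[OF sq] by (simp add: has_L2_gradient_iff plus_fun_def distrib_left)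
qed

lemma has_L2_gradient_cmult:
  assumes "has_L2_gradient f F"
  shows "has_L2_gradient (\<lambda>x. c * f x) (\<lambda>x. c * F x)"
  using assms square_integrable_cmult[OF square_integrable_gradient[OF assms]]
  by (simp add: has_L2_gradient_iff mult.left_commute[of _ c])

lemma has_L2_gradient_zero: "has_L2_gradient 0 (\<lambda>x. 0)"
  by (simp add: has_L2_gradient_iff zero_fun_def square_integrable_def)

lemma H10_gradient: "f \<in> H10 \<Longrightarrow> has_L2_gradient f (gradient f)"
  unfolding gradient_def by (rule someI_ex[of "has_L2_gradient f"]) (simp add: H10_def)

lemma H10_endpoints: "f \<in> H10 \<Longrightarrow> f 0 = 0" "f \<in> H10 \<Longrightarrow> f 1 = 0"
  and H10_outside: "f \<in> H10 \<Longrightarrow> x \<notin> {0..1} \<Longrightarrow> f x = 0"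
  by (auto simp: H10_def)

lemma E_form_self: "f \<in> H10 \<Longrightarrow> E_form f f = (\<integral>x. gradient f x * gradient f x \<partial>lborel01)"
  by (intro E_form_eq H10_gradient)

lemma semi_inner_E_form: "semi_inner (\<lambda>c f x. c * f x) H10 E_form"
proof
  show "fun_space.subspace H10"
  proof (rule fun_space.subspaceI)
    show "0 \<in> H10" using has_L2_gradient_zero by (auto simp: H10_def)
    show "f + g \<in> H10" if "f \<in> H10" "g \<in> H10" for f g
      using that has_L2_gradient_add[OF H10_gradient[OF that(1)] H10_gradient[OF that(2)]]
      by (auto simp: H10_def)
    show "(\<lambda>x. c * f x) \<in> H10" if "f \<in> H10" for c f
      using that has_L2_gradient_cmult[OF H10_gradient[OF that]] by (auto simp: H10_def)
  qed
next
  fix f g :: "real \<Rightarrow> real" and c :: real assume "f \<in> H10" "g \<in> H10"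
  note fg = this [THEN H10_gradient]
  show "E_form f g = E_form g f"
    by (simp add: E_form_eq[OF fg] E_form_eq[OF fg(2,1)] mult.commute)
  show "E_form (\<lambda>x. c * f x) g = c * E_form f g"
    by (simp add: E_form_eq[OF fg] E_form_eq[OF has_L2_gradient_cmult[OF fg(1)] fg(2)] mult.assoc)
next
  fix f g h assume "f \<in> H10" "g \<in> H10" "h \<in> H10"
  note fgh = this [THEN H10_gradient] this [THEN H10_gradient, THEN square_integrable_gradient]
  show "E_form (f + g) h = E_form f h + E_form g h"
    by (simp add: E_form_eq[OF fgh(1,3)] E_form_eq[OF fgh(2,3)] E_form_eq[OF has_L2_gradient_add[OF fgh(1,2)] fgh(3)]
        distrib_right square_integrable_mult[OF fgh(4,6)] square_integrable_mult[OF fgh(5,6)])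
next
  fix f assume "f \<in> H10"
  then show "0 \<le> E_form f f" by (simp add: E_form_self)
qed

interpretation E_form: semi_inner "\<lambda>c f x. c * f x" H10 E_form
  by (rule semi_inner_E_form)

lemma H10_holder:
  assumes "f \<in> H10" "x \<in> {0..1}" "y \<in> {0..1}"
  shows "\<bar>f x - f y\<bar> \<le> sqrt \<bar>x - y\<bar> * sqrt (E_form f f)"
proof -
  have "(f x - f y)\<^sup>2 \<le> \<bar>x - y\<bar> * E_form f f"
  proof (cases "x \<le> y")
    case True
    then show ?thesis
      using gradient_holder[OF H10_gradient[OF assms(1)], of x y] assms
      by (simp add: E_form_self power2_commute)
  next
    case False
    then show ?thesis
      using gradient_holder[OF H10_gradient[OF assms(1)], of y x] assms
      by (simp add: E_form_self)
  qed
  then have "sqrt ((f x - f y)\<^sup>2) \<le> sqrt (\<bar>x - y\<bar> * E_form f f)" by (rule real_sqrt_le_mono)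
  then show ?thesis by (simp add: real_sqrt_mult)
qed

text \<open>The Hoelder estimate relative to the boundary value 0 at the left endpoint; outside the
  interval \<open>f\<close> is zero by the encoding.\<close>

lemma H10_bound:
  assumes "f \<in> H10"
  shows "\<bar>f x\<bar> \<le> sqrt (E_form f f)"
proof (cases "x \<in> {0..1}")
  case True
  then have "\<bar>f x\<bar> \<le> sqrt \<bar>x\<bar> * sqrt (E_form f f)"
    using H10_holder[OF assms True, of 0] H10_endpoints[OF assms] by simp
  also have "\<dots> \<le> 1 * sqrt (E_form f f)"
    by (intro mult_right_mono) (use True assms E_form.nonneg in auto)
  finally show ?thesis by simp
next
  case False
  then show ?thesis using assms E_form.nonneg[of f] by (simp add: H10_outside)
qed

lemma H10_continuous:
  assumes "f \<in> H10"
  shows "continuous_on {0..1} f"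
  unfolding continuous_on_def
proof
  fix x :: real assume x: "x \<in> {0..1}"
  have "((\<lambda>y. sqrt \<bar>y - x\<bar> * sqrt (E_form f f)) \<longlongrightarrow> sqrt \<bar>x - x\<bar> * sqrt (E_form f f)) (at x within {0..1})"
    by (intro tendsto_intros)
  then have lim: "((\<lambda>y. sqrt \<bar>y - x\<bar> * sqrt (E_form f f)) \<longlongrightarrow> 0) (at x within {0..1})"
    by simp
  have "((\<lambda>y. f y - f x) \<longlongrightarrow> 0) (at x within {0..1})"
    by (rule Lim_null_comparison[OF _ lim])
       (use H10_holder[OF assms _ x] in \<open>auto simp: eventually_at_filter\<close>)
  then show "(f \<longlongrightarrow> f x) (at x within {0..1})" by (rule Lim_null[THEN iffD2])
qed

lemma H10_measurable:
  assumes "f \<in> H10"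
  shows "f \<in> borel_measurable borel"
proof -
  have "(\<lambda>x. if x \<in> {0..1} then f x else 0) \<in> borel_measurable borel"
    by (intro borel_measurable_continuous_on_if H10_continuous[OF assms]) auto
  moreover have "(\<lambda>x. if x \<in> {0..1} then f x else 0) = f"
    using H10_outside[OF assms] by auto
  ultimately show ?thesis by simp
qed

text \<open>The gradients converge in mean square to some \<open>g\<close>, and the primitive of
  \<open>g\<close> is the limit; it remains to check its boundary values.\<close>

lemma E_form_complete:
  fixes F :: "nat \<Rightarrow> real \<Rightarrow> real"
  assumes F: "\<And>n. F n \<in> H10"
    and cauchy: "\<And>\<epsilon>. \<epsilon> > 0 \<Longrightarrow> \<exists>N. \<forall>m\<ge>N. \<forall>n\<ge>N. E_form (F m - F n) (F m - F n) < \<epsilon>"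
  shows "\<exists>f\<in>H10. (\<lambda>n. E_form (F n - f) (F n - f)) \<longlonglongrightarrow> 0"
proof -
  have grad: "has_L2_gradient (F n) (gradient (F n))" for n by (intro H10_gradient F)
  have grad_diff: "has_L2_gradient (F m - f) (\<lambda>x. gradient (F m) x - g x)"
    if "has_L2_gradient f g" for m f g
    using has_L2_gradient_add[OF grad[of m] has_L2_gradient_cmult[OF that, of "-1"]]
    by (simp add: plus_fun_def fun_diff_def)
  have E_diff: "E_form (F m - f) (F m - f) = (\<integral>x. (gradient (F m) x - g x)\<^sup>2 \<partial>lborel01)"
    if "has_L2_gradient f g" for m f g
    by (simp add: E_form_eq[OF grad_diff[OF that] grad_diff[OF that]] power2_eq_square)
  obtain g where g: "square_integrable lborel01 g"
      and lim: "(\<lambda>n. \<integral>x. (gradient (F n) x - g x)\<^sup>2 \<partial>lborel01) \<longlonglongrightarrow> 0"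
    using square_integrable_complete[of lborel01 "\<lambda>n. gradient (F n)"]
      square_integrable_gradient[OF grad] cauchy by (auto simp: E_diff[OF grad])
  define f where "f x = (if x \<in> {0..1} then \<integral>t. indicator {0..x} t * g t \<partial>lborel01 else 0)" for x
  have f: "has_L2_gradient f g" using g by (simp add: has_L2_gradient_iff f_def)
  have lim': "(\<lambda>n. E_form (F n - f) (F n - f)) \<longlonglongrightarrow> 0"
    using lim by (simp add: E_diff[OF f])
  have "(\<integral>t. indicator {0..0} t * g t \<partial>lborel01) = (\<integral>t. 0 \<partial>lborel01)"
  proof (rule integral_cong_AE)
    show "(\<lambda>t. indicator {0..0} t * g t) \<in> borel_measurable lborel01"
      by (intro borel_measurable_times square_integrable_measurable[OF g]
          square_integrable_measurable[OF square_integrable_indicator]) simp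
    show "AE t in lborel01. indicator {0..0} t * g t = 0"
      using AE_lborel_singleton[of "0::real"]
      by (intro AE_lborel01) (auto elim!: eventually_mono simp: indicator_def)
  qed simp
  then have f0: "f 0 = 0" by (simp add: f_def)
  have f1: "f 1 = 0"
  proof -
    \<comment> \<open>The difference \<open>F n - f\<close> is 0 at 0 and \<open>- f 1\<close> at 1,
      so its energy controls \<open>f 1\<close>.\<close>
    have "(f 1)\<^sup>2 \<le> E_form (F n - f) (F n - f)" for n
      using gradient_holder[OF grad_diff[OF f], of 0 1 n] H10_endpoints[OF F, of n] f0
      by (simp add: E_diff[OF f] flip: power2_eq_square)
    then have "(f 1)\<^sup>2 \<le> 0" by (intro LIMSEQ_le_const[OF lim']) auto
    then show ?thesis by simp
  qed
  have "f \<in> H10" using f f0 f1 by (auto simp: H10_def f_def)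
  with lim' show ?thesis by blast
qed

text \<open>The hat on \<open>{u..v}\<close> with peak 1 at \<open>w\<close>. The clamped form
  expresses each slope through the length of the part of \<open>{u..w}\<close> or
  \<open>{w..v}\<close> to the left of \<open>x\<close>, so the tent is visibly a primitive of a
  step function.\<close>

definition tent :: "real \<Rightarrow> real \<Rightarrow> real \<Rightarrow> real \<Rightarrow> real" where
  "tent u w v x = (max u (min w x) - u) / (w - u) - (max w (min v x) - w) / (v - w)"

lemma tent_eq:
  assumes "u < w" "w < v"
  shows "tent u w v x =
    (if x \<le> u \<or> v \<le> x then 0 else if x \<le> w then (x - u) / (w - u) else (v - x) / (v - w))"
proof -
  consider "x \<le> u" | "u < x" "x \<le> w" | "w < x" "x < v" | "v \<le> x" by linarith
  then show ?thesis
  proof cases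
    case 3
    then have "tent u w v x = 1 - (x - w) / (v - w)"
      using assms by (simp add: tent_def)
    also have "\<dots> = (v - x) / (v - w)" using assms by (simp add: diff_divide_distrib[symmetric] divide_simps)
    finally show ?thesis using 3 assms by simp
  qed (use assms in \<open>simp_all add: tent_def\<close>)
qed

lemma tent_gradient:
  assumes "0 \<le> u" "u < w" "w < v" "v \<le> 1"
  shows "has_L2_gradient (tent u w v)
    (\<lambda>x. (1 / (w - u)) * indicator {u<..w} x + (- 1 / (v - w)) * indicator {w<..v} x)"
    (is "has_L2_gradient _ ?g")
proof -
  have [simp]: "integrable lborel01 (indicat_real A)" if "A \<in> sets borel" for A
    by (intro lborel01.square_integrable_integrable square_integrable_indicator that)
  have "tent u w v x = (\<integral>t. indicator {0..x} t * ?g t \<partial>lborel01)" if "x \<in> {0..1}" for x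
  proof -
    have "indicator {0..x} t * ?g t = indicat_real {u<..max u (min w x)} t * (1 / (w - u)) +
        (- 1 / (v - w)) * indicat_real {w<..max w (min v x)} t" for t
      using assms by (auto simp: indicator_def)
    then have "(\<integral>t. indicator {0..x} t * ?g t \<partial>lborel01) =
        (\<integral>t. indicat_real {u<..max u (min w x)} t * (1 / (w - u)) +
          (- 1 / (v - w)) * indicat_real {w<..max w (min v x)} t \<partial>lborel01)"
      by simp
    also have "\<dots> = (\<integral>t. indicat_real {u<..max u (min w x)} t \<partial>lborel01) * (1 / (w - u)) +
        (- 1 / (v - w)) * (\<integral>t. indicat_real {w<..max w (min v x)} t \<partial>lborel01)"
      by (subst Bochner_Integration.integral_add) auto
    also have "\<dots> = tent u w v x"
      using assms by (subst (1 2) integral_indicator_lborel01) (auto simp: tent_def)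
    finally show ?thesis by simp
  qed
  moreover have "square_integrable lborel01 ?g"
    by (intro square_integrable_add square_integrable_cmult square_integrable_indicator) auto
  ultimately show ?thesis by (simp add: has_L2_gradient_iff)
qed

lemma tent_H10:
  assumes "0 \<le> u" "u < w" "w < v" "v \<le> 1"
  shows "tent u w v \<in> H10"
  using tent_gradient[OF assms] assms by (auto simp: H10_def tent_eq)

text \<open>The gradient of the tent is constant on each half of its base, where the integral of the
  gradient of \<open>f\<close> is an increment. Pairing with a tent thus measures a change of
  slope.\<close>

lemma E_form_tent:
  assumes f: "f \<in> H10" and uwv: "0 \<le> u" "u < w" "w < v" "v \<le> 1"
  shows "E_form f (tent u w v) = (f w - f u) / (w - u) - (f v - f w) / (v - w)"
proof -
  note grad = H10_gradient[OF f]
  have int: "integrable lborel01 (\<lambda>x. indicator A x * gradient f x)" if "A \<in> sets borel" for A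
    by (intro square_integrable_mult square_integrable_indicator square_integrable_gradient[OF grad] that)
  have "E_form f (tent u w v) = (\<integral>x. (1 / (w - u)) * (indicator {u<..w} x * gradient f x) +
      (- 1 / (v - w)) * (indicator {w<..v} x * gradient f x) \<partial>lborel01)"
  proof -
    have "G * (a * I + b * J) = a * (I * G) + b * (J * G)" for a b G I J :: real
      by (simp add: algebra_simps)
    then show ?thesis unfolding E_form_eq[OF grad tent_gradient[OF uwv]] by (simp only:)
  qed
  also have "\<dots> = (1 / (w - u)) * (\<integral>x. indicator {u<..w} x * gradient f x \<partial>lborel01) +
      (- 1 / (v - w)) * (\<integral>x. indicator {w<..v} x * gradient f x \<partial>lborel01)"
    using int by (subst Bochner_Integration.integral_add) auto
  also have "\<dots> = (f w - f u) / (w - u) - (f v - f w) / (v - w)"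
    using uwv by (subst (1 2) gradient_increment[OF grad]) auto
  finally show ?thesis .
qed

section \<open>Affine behaviour on the gaps of the support and lower bounds for the number of
  eigenvalues\<close>

section \<open>Eigenfunctions and the counting function\<close>

text \<open>Every point off the support has an open null neighbourhood, and finitely many of these
  cover \<open>K\<close>.\<close>

lemma compact_null_if_disjoint_supp:
  assumes sets: "sets \<nu> = sets borel" and K: "compact K" and disj: "K \<inter> supp_measure \<nu> = {}"
  shows "emeasure \<nu> K = 0"
proof -
  have "\<forall>x\<in>K. \<exists>U. open U \<and> x \<in> U \<and> emeasure \<nu> U = 0"
    using disj by (auto simp: supp_measure_def disjoint_iff)
  then obtain U where U: "\<And>x. x \<in> K \<Longrightarrow> open (U x) \<and> x \<in> U x \<and> emeasure \<nu> (U x) = 0" by metis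
  obtain D where D: "D \<subseteq> K" "finite D" "K \<subseteq> (\<Union>x\<in>D. U x)"
    using compactE_image[OF K, of K U] U by blast
  have "open (\<Union>x\<in>D. U x)" using D U by (intro open_UN) auto
  then have "emeasure \<nu> K \<le> emeasure \<nu> (\<Union>x\<in>D. U x)"
    using D U by (intro emeasure_mono) (auto simp: sets)
  also have "\<dots> \<le> (\<Sum>x\<in>D. emeasure \<nu> (U x))"
    using D U by (intro emeasure_subadditive_finite) (auto simp: sets)
  also have "\<dots> = 0" using D U by (intro sum.neutral) auto
  finally show ?thesis by simp
qed

text \<open>Two points \<open>p < q\<close> of \<open>K\<close> fix the line, and each further point
  lies on it by collinearity of the triple in its sorted order.\<close>

lemma affine_if_collinear:
  fixes f :: "real \<Rightarrow> real"
  assumes col: "\<And>u w v. u \<in> K \<Longrightarrow> w \<in> K \<Longrightarrow> v \<in> K \<Longrightarrow> u < w \<Longrightarrow> w < v \<Longrightarrow>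
    (f w - f u) / (w - u) = (f v - f w) / (v - w)"
  shows "\<exists>c d. \<forall>x\<in>K. f x = c * x + d"
proof (cases "\<exists>p\<in>K. \<exists>q\<in>K. p < q")
  case False
  show ?thesis
  proof (cases "K = {}")
    case nonempty: False
    then obtain p where p: "p \<in> K" by blast
    have "x = p" if "x \<in> K" for x using False p that by (metis linorder_neqE_linordered_idom)
    then show ?thesis by (intro exI[of _ 0] exI[of _ "f p"]) auto
  qed simp
next
  case True
  then obtain p q where pq: "p \<in> K" "q \<in> K" "p < q" by blast
  define c where "c = (f q - f p) / (q - p)"
  have fq: "f q = f p + c * (q - p)" using pq by (simp add: c_def)
  have "f x = f p + c * (x - p)" if x: "x \<in> K" for x
  proof -
    consider "x < p" | "x = p" | "p < x" "x < q" | "x = q" | "q < x" by linarith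
    then show ?thesis
    proof cases
      case 1
      then have "(f p - f x) / (p - x) = c" using col[OF x pq(1,2)] pq by (simp add: c_def)
      then show ?thesis using 1 by (simp add: field_simps)
    next
      case 3
      then have "(f x - f p) * (q - x) = (f q - f x) * (x - p)"
        using col[OF pq(1) x pq(2)] by (simp add: frac_eq_eq)
      then have "(f x - (f p + c * (x - p))) * (q - p) = 0" by (simp add: fq algebra_simps)
      then show ?thesis using pq by simp
    next
      case 5
      then have "(f x - f q) / (x - q) = c" using col[OF pq(1,2) x] pq by (simp add: c_def)
      then have "f x - f q = c * (x - q)" using 5 by (simp add: field_simps)
      then show ?thesis by (simp add: fq algebra_simps)
    qed (use fq in simp_all)
  qed
  then show ?thesis by (intro exI[of _ c] exI[of _ "f p - c * p"]) (simp add: algebra_simps)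
qed

locale interval_measure = finite_measure \<nu> for \<nu> :: "real measure" +
  assumes sets_nu [measurable_cong, simp]: "sets \<nu> = sets borel"
    and null_outside: "emeasure \<nu> (- {0<..<1}) = 0"
begin

definition B_form :: "(real \<Rightarrow> real) \<Rightarrow> (real \<Rightarrow> real) \<Rightarrow> real" where
  "B_form f g = (\<integral>x. f x * g x \<partial>\<nu>)"

lemma space_nu [simp]: "space \<nu> = UNIV"
  using sets_eq_imp_space_eq[OF sets_nu] by simp

lemma H10_square_integrable:
  assumes "f \<in> H10"
  shows "square_integrable \<nu> f"
proof (rule square_integrable_bounded)
  show "f \<in> borel_measurable \<nu>"
    using H10_measurable[OF assms] by simp
  show "\<bar>f x\<bar> \<le> sqrt (E_form f f)" for x by (rule H10_bound[OF assms])
qed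

lemma B_form_bound:
  assumes f: "f \<in> H10" and le: "\<And>x. x \<in> {0..1} \<Longrightarrow> \<bar>f x\<bar> \<le> C"
  shows "B_form f f \<le> measure \<nu> UNIV * C\<^sup>2"
proof -
  have "\<bar>f x\<bar> \<le> C" for x
    using le[of x] le[of 0] H10_outside[OF f, of x] by (cases "x \<in> {0..1}") auto
  then have "(f x)\<^sup>2 \<le> C\<^sup>2" for x
    using power_mono[of "\<bar>f x\<bar>" C 2] by simp
  then have "B_form f f \<le> (\<integral>x. C\<^sup>2 \<partial>\<nu>)"
    unfolding B_form_def
    by (intro integral_mono square_integrable_mult H10_square_integrable f) (auto simp: power2_eq_square)
  then show ?thesis by simp
qed

lemma semi_inner_B_form: "semi_inner (\<lambda>c f x. c * f x) H10 B_form"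
proof -
  interpret L2: semi_inner "\<lambda>c f x. c * f x" "{f. square_integrable \<nu> f}" B_form
    unfolding B_form_def[abs_def] by (rule semi_inner_square_integrable)
  show ?thesis
    by standard (auto intro: E_form.subspace_H L2.sym L2.add_left L2.scale_left L2.nonneg H10_square_integrable)
qed

text \<open>Bounded energy gives a uniform bound and a uniform Hoelder bound, so Arzela-Ascoli
  provides a uniformly convergent subsequence; uniform convergence controls the form because
  \<open>\<nu>\<close> is finite.\<close>

lemma B_form_compact:
  assumes F: "\<And>n. F n \<in> H10" "\<And>n. E_form (F n) (F n) \<le> 1"
  shows "\<exists>r :: nat \<Rightarrow> nat. strict_mono r \<and>
    (\<forall>\<epsilon>>0. \<exists>N. \<forall>m\<ge>N. \<forall>n\<ge>N. B_form (F (r m) - F (r n)) (F (r m) - F (r n)) < \<epsilon>)"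
proof -
  have holder: "norm (F n x - F n y) \<le> sqrt \<bar>x - y\<bar>" if "x \<in> {0..1}" "y \<in> {0..1}" for n x y
  proof -
    have "sqrt \<bar>x - y\<bar> * sqrt (E_form (F n) (F n)) \<le> sqrt \<bar>x - y\<bar> * 1"
      using F by (intro mult_left_mono) auto
    then show ?thesis using H10_holder[OF F(1) that, of n] by simp
  qed
  have bound: "norm (F n x) \<le> 1" for n x
  proof -
    have "sqrt (E_form (F n) (F n)) \<le> 1" using F by simp
    then show ?thesis using order_trans[OF H10_bound[OF F(1)[of n], of x]] by simp
  qed
  obtain g :: "real \<Rightarrow> real" and r :: "nat \<Rightarrow> nat" where r: "strict_mono r"
    and lim: "\<And>e. 0 < e \<Longrightarrow> \<exists>N. \<forall>n x. n \<ge> N \<and> x \<in> {0..1} \<longrightarrow> norm (F (r n) x - g x) < e"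
  proof (rule Arzela_Ascoli[of "{0..1}" F 1])
    fix x e :: real assume xe: "x \<in> {0..1}" "0 < e"
    show "\<exists>d>0. \<forall>n y. y \<in> {0..1} \<and> norm (x - y) < d \<longrightarrow> norm (F n x - F n y) < e"
    proof (intro exI[of _ "e\<^sup>2"] conjI allI impI)
      fix n y assume y: "y \<in> {0..1} \<and> norm (x - y) < e\<^sup>2"
      then have "sqrt \<bar>x - y\<bar> < sqrt (e\<^sup>2)" by (intro real_sqrt_less_mono) simp
      then show "norm (F n x - F n y) < e" using holder[of x y n] y xe by simp
    qed (use xe in simp)
  qed (use bound in auto)
  have "\<exists>N. \<forall>m\<ge>N. \<forall>n\<ge>N. B_form (F (r m) - F (r n)) (F (r m) - F (r n)) < \<epsilon>" if "\<epsilon> > 0" for \<epsilon>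
  proof -
    define C where "C = measure \<nu> UNIV"
    have C: "C \<ge> 0" by (simp add: C_def)
    \<comment> \<open>Two functions within \<open>e\<close> of the limit differ by at most
      \<open>2 * e\<close>, and the total mass \<open>C\<close> times \<open>(2 * e)\<^sup>2\<close>
      is below \<open>\<epsilon>\<close>; the summand 1 keeps the denominator positive.\<close>
    define e where "e = sqrt (\<epsilon> / (C + 1)) / 2"
    have e: "e > 0" using that C by (simp add: e_def)
    have e2: "(2 * e)\<^sup>2 = \<epsilon> / (C + 1)" using that C by (simp add: e_def)
    obtain N where N: "\<And>n x. n \<ge> N \<Longrightarrow> x \<in> {0..1} \<Longrightarrow> norm (F (r n) x - g x) < e"
      using lim[OF e] by blast
    show ?thesis
    proof (intro exI[of _ N] allI impI)
      fix m n assume mn: "m \<ge> N" "n \<ge> N"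
      have "B_form (F (r m) - F (r n)) (F (r m) - F (r n)) \<le> measure \<nu> UNIV * (2 * e)\<^sup>2"
      proof (rule B_form_bound)
        show "F (r m) - F (r n) \<in> H10" using F by simp
        show "\<bar>(F (r m) - F (r n)) x\<bar> \<le> 2 * e" if "x \<in> {0..1}" for x
          using N[OF mn(1) that] N[OF mn(2) that] by (simp add: minus_apply)
      qed
      also have "\<dots> = C * (\<epsilon> / (C + 1))" by (simp only: e2 C_def)
      also have "\<dots> < \<epsilon>" using that C by (simp add: field_simps)
      finally show "B_form (F (r m) - F (r n)) (F (r m) - F (r n)) < \<epsilon>" .
    qed
  qed
  with r show ?thesis by blast
qed

sublocale compact_form "\<lambda>c f x. c * f x" H10 E_form B_form
proof (intro compact_form.intro semi_inner_E_form semi_inner_B_form compact_form_axioms.intro)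
  have "B_form f f \<le> measure \<nu> UNIV * E_form f f" if "f \<in> H10" for f
    using B_form_bound[OF that H10_bound[OF that]] E_form.nonneg[OF that] by simp
  then show "\<exists>C. \<forall>f\<in>H10. B_form f f \<le> C * E_form f f" by blast
qed (use B_form_compact E_form_complete in blast)+

text \<open>A tent with base in a gap of the support has zero \<open>\<nu>\<close>-pairing with
  \<open>f\<close>, so its energy pairing, a difference of slopes of \<open>f\<close>, is zero too.
  Hence \<open>f\<close> is affine on the gap and belongs to the domain.\<close>

lemma weak_eigenfunction_in_eigenspace:
  assumes f: "f \<in> H10" and eig: "\<And>g. g \<in> H10 \<Longrightarrow> E_form f g = l * B_form f g"
  shows "f \<in> eigenspace \<nu> l"
proof -
  have "\<exists>c d. \<forall>x\<in>K. f x = c * x + d" if K: "K \<in> components ({0..1} - supp_measure \<nu>)" for K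
  proof (rule affine_if_collinear)
    fix u w v assume uwv: "u \<in> K" "w \<in> K" "v \<in> K" "u < w" "w < v"
    have sub: "K \<subseteq> {0..1} - supp_measure \<nu>" by (rule in_components_subset[OF K])
    have "{u..v} \<subseteq> K"
      by (rule connected_contains_Icc[OF in_components_connected[OF K] uwv(1,3)])
    then have "emeasure \<nu> {u..v} = 0"
      using sub by (intro compact_null_if_disjoint_supp) auto
    then have "AE x in \<nu>. x \<notin> {u..v}"
      by (intro AE_not_in) (auto simp: null_sets_def)
    then have ae: "AE x in \<nu>. f x * tent u w v x = 0"
      by eventually_elim (use uwv in \<open>auto simp: tent_eq\<close>)
    have "B_form f (tent u w v) = 0"
      unfolding B_form_def by (rule integral_eq_zero_AE[OF ae])
    moreover have "0 \<le> u" "v \<le> 1" using uwv sub by auto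
    ultimately show "(f w - f u) / (w - u) = (f v - f w) / (v - w)"
      using E_form_tent[OF f, of u w v] eig[OF tent_H10, of u w v] uwv by simp
  qed
  then have "f \<in> dom_E \<nu>"
    using f H10_continuous[OF f] by (auto simp: dom_E_def C_nu_def)
  then show ?thesis
    using eig by (auto simp: eigenspace_def dom_E_def B_form_def)
qed

text \<open>In \<open>enat\<close> the infinite sum is the supremum of its finite partial
  sums.\<close>

lemma sum_le_N_count:
  assumes "finite L" "\<And>l. l \<in> L \<Longrightarrow> eigenvalue \<nu> l \<and> l \<le> x"
  shows "(\<Sum>l\<in>L. multiplicity_E \<nu> l) \<le> N_count \<nu> x"
proof -
  have bdd: "bdd_above (sum (multiplicity_E \<nu>) ` A)" for A by simp
  show ?thesis
    unfolding N_count_def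
    by (subst nonneg_bdd_above_infsum)
       (use assms bdd in \<open>auto intro!: cSUP_upper\<close>)
qed

text \<open>Orthonormality makes the \<open>e i\<close> distinct and linearly independent within
  each eigenspace. The fibres of \<open>l\<close> partition \<open>{..<m}\<close>, so the
  multiplicities add up to at least \<open>m\<close>.\<close>

lemma N_count_ge:
  fixes e :: "nat \<Rightarrow> real \<Rightarrow> real"
  assumes e: "\<And>i. i < m \<Longrightarrow> e i \<in> H10" and l: "\<And>i. i < m \<Longrightarrow> l i \<le> x"
    and ortho: "\<And>i j. i < m \<Longrightarrow> j < m \<Longrightarrow> E_form (e i) (e j) = (if i = j then 1 else 0)"
    and eig: "\<And>i g. i < m \<Longrightarrow> g \<in> H10 \<Longrightarrow> E_form (e i) g = l i * B_form (e i) g"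
  shows "enat m \<le> N_count \<nu> x"
proof -
  have space: "e i \<in> eigenspace \<nu> (l i)" if "i < m" for i
    using weak_eigenfunction_in_eigenspace[OF e[OF that] eig[OF that]] .
  have inj: "inj_on e {..<m}"
  proof (rule inj_onI)
    fix i j assume ij: "i \<in> {..<m}" "j \<in> {..<m}" "e i = e j"
    then have "E_form (e i) (e j) = 1" using ortho[of j j] by simp
    then show "i = j" using ortho[of i j] ij by (auto split: if_splits)
  qed
  have "eigenvalue \<nu> (l i)" if i: "i < m" for i
  proof -
    have "e i \<noteq> 0" using ortho[OF i i] E_form.zero_left[of 0] E_form.mem(1) by force
    then show ?thesis using space[OF i] by (auto simp: eigenvalue_def)
  qed
  then have "(\<Sum>\<mu>\<in>l ` {..<m}. multiplicity_E \<nu> \<mu>) \<le> N_count \<nu> x"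
    using l by (intro sum_le_N_count) auto
  moreover have "(\<Sum>\<mu>\<in>l ` {..<m}. enat (card {i \<in> {..<m}. l i = \<mu>})) \<le> (\<Sum>\<mu>\<in>l ` {..<m}. multiplicity_E \<nu> \<mu>)"
  proof (rule sum_mono)
    fix \<mu>
    define J where "J = {i \<in> {..<m}. l i = \<mu>}"
    have J: "finite J" "J \<subseteq> {..<m}" by (auto simp: J_def)
    have "fun_space.independent (e ` J)"
    proof (rule fun_space.independent_if_scalars_zero)
      fix c f assume zero: "(\<Sum>f\<in>e ` J. (\<lambda>x. c f * f x)) = 0" and "f \<in> e ` J"
      then obtain j where j: "j \<in> J" "f = e j" by auto
      have "0 = E_form (\<Sum>i\<in>J. (\<lambda>x. c (e i) * e i x)) (e j)"
        using zero E_form.zero_left[OF e] j J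
        by (subst (asm) sum.reindex[OF inj_on_subset[OF inj J(2)]]) auto
      also have "\<dots> = (\<Sum>i\<in>J. E_form (\<lambda>x. c (e i) * e i x) (e j))"
        by (rule E_form.sum_left) (use e j J in \<open>auto intro!: E_form.mem\<close>)
      also have "\<dots> = (\<Sum>i\<in>J. if j = i then c (e i) else 0)"
        by (intro sum.cong refl) (use e j J ortho E_form.scale_left in \<open>auto simp: subset_iff\<close>)
      also have "\<dots> = c f" using j J by simp
      finally show "c f = 0" by simp
    qed (use J in simp)
    moreover have "e ` J \<subseteq> eigenspace \<nu> \<mu>" using space by (auto simp: J_def)
    moreover have "card (e ` J) = card J"
      by (rule card_image[OF inj_on_subset[OF inj J(2)]])
    ultimately show "enat (card {i \<in> {..<m}. l i = \<mu>}) \<le> multiplicity_E \<nu> \<mu>"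
      unfolding multiplicity_E_def J_def[symmetric]
      by (intro Sup_upper CollectI exI[of _ "e ` J"]) (use J in auto)
  qed
  moreover have "(\<Sum>\<mu>\<in>l ` {..<m}. enat (card {i \<in> {..<m}. l i = \<mu>})) = enat m"
  proof -
    have "(\<Sum>\<mu>\<in>l ` {..<m}. card {i \<in> {..<m}. l i = \<mu>}) = m"
      using sum.group[of "{..<m}" "l ` {..<m}" l "\<lambda>_. 1 :: nat"] by simp
    then show ?thesis by (simp flip: of_nat_eq_enat of_nat_sum)
  qed
  ultimately show ?thesis by (metis order_trans)
qed

text \<open>For functions orthogonal in both forms, both forms are diagonal on the span, so a bound
  for the individual Rayleigh quotients holds for all combinations.\<close>

lemma N_count_ge_orthogonal:
  assumes I: "finite I" and v: "\<And>i. i \<in> I \<Longrightarrow> v i \<in> H10"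
    and pos: "\<And>i. i \<in> I \<Longrightarrow> B_form (v i) (v i) > 0"
    and le: "\<And>i. i \<in> I \<Longrightarrow> E_form (v i) (v i) \<le> x * B_form (v i) (v i)"
    and ortho: "\<And>i j. i \<in> I \<Longrightarrow> j \<in> I \<Longrightarrow> i \<noteq> j \<Longrightarrow> E_form (v i) (v j) = 0 \<and> B_form (v i) (v j) = 0"
  shows "enat (card I) \<le> N_count \<nu> x"
proof -
  have diag: "G (\<Sum>i\<in>I. (\<lambda>x. c i * v i x)) (\<Sum>i\<in>I. (\<lambda>x. c i * v i x)) = (\<Sum>i\<in>I. (c i)\<^sup>2 * G (v i) (v i))"
    if "semi_inner (\<lambda>c f x. c * f x) H10 G"
      and o: "\<And>i j. i \<in> I \<Longrightarrow> j \<in> I \<Longrightarrow> i \<noteq> j \<Longrightarrow> G (v i) (v j) = 0" for G c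
  proof -
    interpret G: semi_inner "\<lambda>c f x. c * f x" H10 G by fact
    let ?w = "\<lambda>i x. c i * v i x"
    have w: "?w i \<in> H10" if "i \<in> I" for i using v[OF that] by (intro G.mem)
    have s: "(\<Sum>i\<in>I. ?w i) \<in> H10" by (intro G.mem w)
    have "G (\<Sum>i\<in>I. ?w i) (\<Sum>i\<in>I. ?w i) = (\<Sum>i\<in>I. G (?w i) (\<Sum>i\<in>I. ?w i))"
      by (rule G.sum_left[OF w s])
    also have "\<dots> = (\<Sum>i\<in>I. \<Sum>j\<in>I. G (?w i) (?w j))"
      by (intro sum.cong refl G.sum_right w)
    also have "\<dots> = (\<Sum>i\<in>I. \<Sum>j\<in>I. if i = j then (c i)\<^sup>2 * G (v i) (v i) else 0)"
    proof (intro sum.cong refl)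
      fix i j assume ij: "i \<in> I" "j \<in> I"
      have "G (?w i) (?w j) = c i * (c j * G (v i) (v j))"
        using G.scale_left[OF v[OF ij(1)] w[OF ij(2)]] G.scale_right[OF v[OF ij(2)] v[OF ij(1)]] by simp
      then show "G (?w i) (?w j) = (if i = j then (c i)\<^sup>2 * G (v i) (v i) else 0)"
        using o[OF ij] by (simp add: power2_eq_square)
    qed
    also have "\<dots> = (\<Sum>i\<in>I. (c i)\<^sup>2 * G (v i) (v i))" using I by simp
    finally show ?thesis .
  qed
  note Bd = diag[OF semi_inner_B_form] and Ed = diag[OF semi_inner_E_form]
  have "\<exists>(e :: nat \<Rightarrow> real \<Rightarrow> real) l. \<forall>i<card I. e i \<in> H10 \<and> l i \<le> x \<and>
    (\<forall>j<card I. E_form (e i) (e j) = (if i = j then 1 else 0)) \<and>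
    (\<forall>g\<in>H10. E_form (e i) g = l i * B_form (e i) g)"
  proof (rule eigenvectors[OF I refl v])
    fix c :: "_ \<Rightarrow> real" assume "\<exists>i\<in>I. c i \<noteq> 0"
    then obtain p where p: "p \<in> I" "c p \<noteq> 0" by blast
    let ?s = "\<Sum>i\<in>I. (\<lambda>x. c i * v i x)"
    have "0 < (\<Sum>i\<in>I. (c i)\<^sup>2 * B_form (v i) (v i))"
      by (rule sum_pos2[OF I p(1)]) (use p pos less_imp_le[OF pos] in auto)
    moreover have "(\<Sum>i\<in>I. (c i)\<^sup>2 * E_form (v i) (v i)) \<le> x * (\<Sum>i\<in>I. (c i)\<^sup>2 * B_form (v i) (v i))"
      unfolding sum_distrib_left mult.left_commute[of x]
      by (intro sum_mono mult_left_mono le) auto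
    ultimately show "0 < B_form ?s ?s \<and> E_form ?s ?s \<le> x * B_form ?s ?s"
      using Bd[of c] Ed[of c] ortho by simp
  qed
  then obtain e :: "nat \<Rightarrow> real \<Rightarrow> real" and l where *: "\<forall>i<card I. e i \<in> H10 \<and> l i \<le> x \<and>
    (\<forall>j<card I. E_form (e i) (e j) = (if i = j then 1 else 0)) \<and>
    (\<forall>g\<in>H10. E_form (e i) g = l i * B_form (e i) g)" by blast
  show ?thesis
  proof (rule N_count_ge[where l = l])
    fix i j assume "i < card I" "j < card I"
    then show "E_form (e i) (e j) = (if i = j then 1 else 0)"
      using *[THEN spec, THEN mp, THEN conjunct2, THEN conjunct2, THEN conjunct1, of i] by simp
  qed (use * in simp_all)
qed

end

section \<open>Orthogonal test functions from cells of large mass\<close>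

section \<open>Tents over dyadic cells\<close>

text \<open>The base consists of the cell from \<open>c\<close> to \<open>c + h\<close> and one cell
  on either side, with the peak in the middle; at both ends of the cell the height is
  \<open>h / (3 / 2 * h)\<close>.\<close>

lemma tent_ge_two_thirds:
  assumes "0 < h" "c \<le> x" "x \<le> c + h"
  shows "2 / 3 \<le> tent (c - h) (c + h / 2) (c + 2 * h) x"
proof (cases "x \<le> c + h / 2")
  case True
  then have "tent (c - h) (c + h / 2) (c + 2 * h) x = (x - c + h) / (3 / 2 * h)"
    using assms by (simp add: tent_eq algebra_simps)
  moreover have "2 / 3 \<le> (x - c + h) / (3 / 2 * h)" using assms by (simp add: field_simps)
  ultimately show ?thesis by simp
next
  case False
  then have "tent (c - h) (c + h / 2) (c + 2 * h) x = (c + 2 * h - x) / (3 / 2 * h)"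
    using assms by (simp add: tent_eq)
  moreover have "2 / 3 \<le> (c + 2 * h - x) / (3 / 2 * h)" using assms by (simp add: field_simps)
  ultimately show ?thesis by simp
qed

lemma E_form_tent_self:
  assumes "0 \<le> c - h" "0 < h" "c + 2 * h \<le> 1"
  shows "E_form (tent (c - h) (c + h / 2) (c + 2 * h)) (tent (c - h) (c + h / 2) (c + 2 * h)) = 4 / (3 * h)"
  using assms by (simp add: E_form_tent tent_H10 tent_eq field_simps)

lemma E_form_tent_disjoint:
  assumes "0 \<le> u" "u < w" "w < v" "v \<le> u'" "u' < w'" "w' < v'" "v' \<le> 1"
  shows "E_form (tent u w v) (tent u' w' v') = 0"
  using assms by (simp add: E_form_tent tent_H10 tent_eq)

text \<open>Pigeonhole. Distinct indices of one class differ by at least 3, so their tents, with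
  bases three cells wide, meet at most in an endpoint.\<close>

lemma residue_class_mod_3:
  fixes K :: "nat set"
  assumes "finite K"
  shows "\<exists>j. card K \<le> 3 * card {k \<in> K. k mod 3 = j}"
proof (rule ccontr)
  assume "\<not> ?thesis"
  then have less: "3 * card {k \<in> K. k mod 3 = j} < card K" for j by (simp add: not_le)
  have "(\<lambda>k. k mod 3) ` K \<subseteq> {..<3}" by auto
  then have "card K = (\<Sum>j\<in>{..<3}. card {k \<in> K. k mod 3 = j})"
    using sum.group[of K "{..<3}" "\<lambda>k. k mod 3" "\<lambda>_. 1 :: nat"] assms by simp
  also have "\<dots> = card {k \<in> K. k mod 3 = 0} + card {k \<in> K. k mod 3 = 1} + card {k \<in> K. k mod 3 = 2}"
  proof -
    have "{..<3 :: nat} = {0, 1, 2}" by auto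
    then show ?thesis by simp
  qed
  finally show False using less[of 0] less[of 1] less[of 2] by linarith
qed

context interval_measure
begin

text \<open>A tent over a heavy cell has energy \<open>4 / (3 * h)\<close> and
  \<open>\<nu>\<close>-form at least \<open>4 / 9 * \<delta>\<close>, hence Rayleigh quotient at
  most \<open>3 * 2 ^ n / \<delta> \<le> x\<close>. The range of \<open>k\<close> excludes the first
  and the last cell, where the base would leave the unit interval.\<close>

lemma card_heavy_cells_le_N_count:
  assumes K: "\<And>k. k \<in> K \<Longrightarrow> 1 \<le> k \<and> k + 2 \<le> 2 ^ n"
    and heavy: "\<And>k. k \<in> K \<Longrightarrow> \<delta> \<le> measure \<nu> (dyadic_cell n k)"
    and \<delta>: "0 < \<delta>" and x: "3 * 2 ^ n \<le> x * \<delta>"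
  shows "\<exists>m. card K \<le> 3 * m \<and> enat m \<le> N_count \<nu> x"
proof -
  define h :: real where "h = 1 / 2 ^ n"
  have h: "h > 0" by (simp add: h_def)
  define c where "c k = real k * h" for k
  define T where "T k = tent (c k - h) (c k + h / 2) (c k + 2 * h)" for k
  have "K \<subseteq> {..2 ^ n}" using K by fastforce
  then have "finite K" by (rule finite_subset) simp
  then obtain j where j: "card K \<le> 3 * card {k \<in> K. k mod 3 = j}"
    using residue_class_mod_3 by blast
  define I where "I = {k \<in> K. k mod 3 = j}"
  have cell: "dyadic_cell n k = {c k <.. c k + h}" for k
    by (simp add: dyadic_cell_def c_def h_def add_divide_distrib)
  have range: "0 \<le> c k - h" "c k + 2 * h \<le> 1" if "k \<in> K" for k
  proof -
    have "1 * h \<le> real k * h" using K[OF that] h by (intro mult_right_mono) auto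
    then show "0 \<le> c k - h" by (simp add: c_def)
    have "real (k + 2) \<le> real (2 ^ n)" using K[OF that] by (simp only: of_nat_le_iff)
    then have "(real k + 2) * h \<le> 2 ^ n * h" using h by (intro mult_right_mono) auto
    then show "c k + 2 * h \<le> 1" by (simp add: c_def h_def field_simps)
  qed
  have TH: "T k \<in> H10" if "k \<in> K" for k
    unfolding T_def using range[OF that] h by (intro tent_H10) auto
  have ET: "E_form (T k) (T k) = 4 / (3 * h)" if "k \<in> K" for k
    unfolding T_def using range[OF that] h by (intro E_form_tent_self) auto
  have BT: "4 / 9 * measure \<nu> (dyadic_cell n k) \<le> B_form (T k) (T k)" if "k \<in> K" for k
  proof -
    have "(\<integral>x. 4 / 9 * indicator (dyadic_cell n k) x \<partial>\<nu>) \<le> (\<integral>x. T k x * T k x \<partial>\<nu>)"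
    proof (rule integral_mono)
      show "integrable \<nu> (\<lambda>x. 4 / 9 * indicat_real (dyadic_cell n k) x)"
        by (intro integrable_mult_right integrable_real_indicator) (auto simp: cell less_top[symmetric])
      show "integrable \<nu> (\<lambda>x. T k x * T k x)"
        by (intro square_integrable_mult H10_square_integrable TH that)
      fix x
      show "4 / 9 * indicat_real (dyadic_cell n k) x \<le> T k x * T k x"
      proof (cases "x \<in> dyadic_cell n k")
        case True
        then have "2 / 3 \<le> T k x" unfolding T_def cell by (intro tent_ge_two_thirds) (use h in auto)
        then have "2 / 3 * (2 / 3) \<le> T k x * T k x" by (intro mult_mono) auto
        then show ?thesis using True by simp
      qed simp
    qed
    then show ?thesis by (simp add: B_form_def cell)
  qed
  have disjoint: "E_form (T k) (T k') = 0 \<and> B_form (T k) (T k') = 0"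
    if "k \<in> K" "k' \<in> K" "k + 3 \<le> k'" for k k'
  proof
    have "real (k + 3) \<le> real k'" using that(3) by (simp only: of_nat_le_iff)
    then have "(real k + 3) * h \<le> real k' * h" using h by (intro mult_right_mono) auto
    then have sep: "c k + 2 * h \<le> c k' - h" by (simp add: c_def algebra_simps)
    show "E_form (T k) (T k') = 0"
      unfolding T_def using range(1)[OF that(1)] range(2)[OF that(2)] sep h
      by (intro E_form_tent_disjoint) auto
    have "T k x * T k' x = 0" for x
      unfolding T_def using sep h by (cases "x \<le> c k' - h") (simp_all add: tent_eq)
    then show "B_form (T k) (T k') = 0" by (simp only: B_form_def integral_zero)
  qed
  have "enat (card I) \<le> N_count \<nu> x"
  proof (rule N_count_ge_orthogonal[of I T])
    fix k assume "k \<in> I"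
    then have k: "k \<in> K" by (simp add: I_def)
    have B: "4 / 9 * \<delta> \<le> B_form (T k) (T k)" using BT[OF k] heavy[OF k] by simp
    show "T k \<in> H10" by (rule TH[OF k])
    show "0 < B_form (T k) (T k)" using B \<delta> by simp
    have "x > 0"
      using x \<delta> zero_less_mult_pos2[of x \<delta>] less_le_trans[of 0 "3 * 2 ^ n" "x * \<delta>"] by simp
    have "E_form (T k) (T k) = 4 / 9 * (3 * 2 ^ n)" by (simp add: ET[OF k] h_def)
    also have "\<dots> \<le> 4 / 9 * (x * \<delta>)" using x by (intro mult_left_mono) auto
    also have "\<dots> = x * (4 / 9 * \<delta>)" by (simp add: mult.commute)
    also have "\<dots> \<le> x * B_form (T k) (T k)" using B \<open>x > 0\<close> by (intro mult_left_mono) auto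
    finally show "E_form (T k) (T k) \<le> x * B_form (T k) (T k)" .
  next
    fix k k' assume "k \<in> I" "k' \<in> I" "k \<noteq> k'"
    then have k: "k \<in> K" "k' \<in> K" and mod: "k mod 3 = k' mod 3" "k \<noteq> k'" by (auto simp: I_def)
    from mod have "k + 3 \<le> k' \<or> k' + 3 \<le> k" by presburger
    then show "E_form (T k) (T k') = 0 \<and> B_form (T k) (T k') = 0"
    proof
      assume "k + 3 \<le> k'"
      then show ?thesis by (rule disjoint[OF k])
    next
      assume "k' + 3 \<le> k"
      from disjoint[OF k(2,1) this] show ?thesis
        by (simp add: E_form.sym[OF TH[OF k(1)] TH[OF k(2)]] B.sym[OF TH[OF k(1)] TH[OF k(2)]])
    qed
  qed (use \<open>finite K\<close> in \<open>simp add: I_def\<close>)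
  with j show ?thesis unfolding I_def by blast
qed

text \<open>A single tent over the whole interval is positive on \<open>{0<..<1}\<close>, so its
  \<open>\<nu>\<close>-form is positive.\<close>

lemma N_count_ge_1:
  assumes nonzero: "emeasure \<nu> {0<..<1} \<noteq> 0"
  shows "\<forall>\<^sub>F x in at_top. 1 \<le> N_count \<nu> x"
proof -
  define T where "T = tent 0 (1 / 2) 1"
  have T: "T \<in> H10" unfolding T_def by (intro tent_H10) auto
  have "B_form T T \<noteq> 0"
  proof
    assume "B_form T T = 0"
    then have "AE x in \<nu>. T x * T x = 0"
      using integral_nonneg_eq_0_iff_AE[of \<nu> "\<lambda>x. T x * T x"]
        square_integrable_mult[OF H10_square_integrable[OF T] H10_square_integrable[OF T]]
      by (simp add: B_form_def)
    then have "AE x in \<nu>. x \<notin> {0<..<1}"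
      by eventually_elim (auto simp: T_def tent_eq split: if_splits)
    then have "{0<..<1} \<in> null_sets \<nu>" by (subst AE_iff_null_sets) auto
    then show False using nonzero by auto
  qed
  then have pos: "B_form T T > 0" using B.nonneg[OF T] by simp
  show ?thesis
    using eventually_ge_at_top[of "E_form T T / B_form T T"]
  proof eventually_elim
    case (elim x)
    have "enat (card {()}) \<le> N_count \<nu> x"
      by (rule N_count_ge_orthogonal[of _ "\<lambda>_. T"]) (use T pos elim in \<open>auto simp: field_simps\<close>)
    then show ?case by (simp add: one_enat_def)
  qed
qed

end

section \<open>Partition sums, their growth rate and the cells that dominate them\<close>

section \<open>Counting heavy cells\<close>

context interval_measure
begin

definition charged_indices :: "nat \<Rightarrow> nat set" where
  "charged_indices n = {k. k < 2 ^ n \<and> 0 < measure \<nu> (dyadic_cell n k)}"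

definition partition_sum :: "nat \<Rightarrow> real \<Rightarrow> real" where
  "partition_sum n q = (\<Sum>k\<in>charged_indices n. measure \<nu> (dyadic_cell n k) powr q)"

lemma finite_charged_indices [simp]: "finite (charged_indices n)"
  by (simp add: charged_indices_def)

text \<open>A half-open cell contains its right endpoint as its maximum, which determines
  \<open>k\<close>. This lets sums over cells be written as sums over indices.\<close>

lemma inj_dyadic_cell: "inj (dyadic_cell n)"
proof (rule injI)
  have le: "k \<le> k'" if eq: "dyadic_cell n k = dyadic_cell n k'" for k k'
  proof -
    have "(real k + 1) / 2 ^ n \<in> dyadic_cell n k"
      by (simp add: dyadic_cell_def divide_strict_right_mono)
    then have "(real k + 1) / 2 ^ n \<in> dyadic_cell n k'" by (simp only: eq)
    then have "(real k + 1) / 2 ^ n \<le> (real k' + 1) / 2 ^ n" by (simp add: dyadic_cell_def)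
    then show ?thesis by (simp add: divide_le_cancel)
  qed
  show "k = k'" if "dyadic_cell n k = dyadic_cell n k'" for k k'
    using le[OF that] le[OF that[symmetric]] by simp
qed

lemma beta_n_eq: "beta_n \<nu> n q = ln (partition_sum n q) / (real n * ln 2)"
proof -
  have "charged_cells \<nu> n = dyadic_cell n ` charged_indices n"
    by (auto simp: charged_cells_def charged_indices_def)
  then have "(\<Sum>C\<in>charged_cells \<nu> n. measure \<nu> C powr q) = partition_sum n q"
    by (simp add: partition_sum_def sum.reindex[OF inj_on_subset[OF inj_dyadic_cell subset_UNIV]])
  then show ?thesis by (simp add: beta_n_def ln_realpow)
qed

lemma sum_cell_masses: "(\<Sum>k<m. measure \<nu> (dyadic_cell n k)) = measure \<nu> {0<..real m / 2 ^ n}"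
proof (induction m)
  case (Suc m)
  have "{0<..b} = {0<..a} \<union> {a<..b}" if "0 \<le> a" "a \<le> b" for a b :: real
    using that by auto
  from this[of "real m / 2 ^ n" "real (Suc m) / 2 ^ n"]
  have "{0<..real (Suc m) / 2 ^ n} = {0<..real m / 2 ^ n} \<union> dyadic_cell n m"
    by (simp add: dyadic_cell_def divide_right_mono add.commute)
  moreover have "measure \<nu> ({0<..real m / 2 ^ n} \<union> dyadic_cell n m) =
      measure \<nu> {0<..real m / 2 ^ n} + measure \<nu> (dyadic_cell n m)"
    by (rule finite_measure_Union) (auto simp: dyadic_cell_def)
  ultimately show ?case using Suc by simp
qed simp

lemma sum_charged_cell_masses: "(\<Sum>k\<in>charged_indices n. measure \<nu> (dyadic_cell n k)) = measure \<nu> UNIV"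
proof -
  have "measure \<nu> UNIV = measure \<nu> ({0<..1} \<union> - {0<..1})" by simp
  also have "\<dots> = measure \<nu> {0<..1} + measure \<nu> (- {0<..1})"
    by (rule finite_measure_Union) auto
  also have "measure \<nu> (- {0<..1}) = 0"
  proof -
    have "emeasure \<nu> (- {0<..1}) \<le> emeasure \<nu> (- {0<..<1})" by (intro emeasure_mono) auto
    then show ?thesis using null_outside by (simp add: measure_def)
  qed
  also have "measure \<nu> {0<..1} = (\<Sum>k<2 ^ n. measure \<nu> (dyadic_cell n k))"
    by (simp add: sum_cell_masses)
  also have "\<dots> = (\<Sum>k\<in>charged_indices n. measure \<nu> (dyadic_cell n k))"
    by (intro sum.mono_neutral_right) (auto simp: charged_indices_def not_less intro: antisym)
  finally show ?thesis by simp
qed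

lemma cell_mass_le: "measure \<nu> (dyadic_cell n k) \<le> measure \<nu> UNIV"
  using bounded_measure[of "dyadic_cell n k"] by simp

end

locale nonzero_interval_measure = interval_measure +
  assumes nonzero: "emeasure \<nu> {0<..<1} \<noteq> 0"
begin

lemma total_mass_pos: "0 < measure \<nu> UNIV"
proof -
  have "emeasure \<nu> {0<..<1} \<le> emeasure \<nu> UNIV" by (intro emeasure_mono) auto
  then have "emeasure \<nu> UNIV \<noteq> 0" using nonzero by auto
  then show ?thesis by (simp add: emeasure_eq_measure zero_less_measure_iff)
qed

lemma partition_sum_pos: "0 < partition_sum n q"
proof -
  have "charged_indices n \<noteq> {}" using sum_charged_cell_masses[of n] total_mass_pos by auto
  then show ?thesis
    unfolding partition_sum_def by (intro sum_pos) (auto simp: charged_indices_def)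
qed

text \<open>Below: for \<open>q \<le> 1\<close> each mass \<open>p\<close> satisfies
  \<open>p powr (q - 1) \<ge> M powr (q - 1)\<close> with \<open>M\<close> the total mass, and the
  masses add up to \<open>M\<close>. Above: each term is at most \<open>1 + p\<close>, and there are
  at most \<open>2 ^ n\<close> terms.\<close>

lemma partition_sum_bounds:
  assumes "0 \<le> q" "q \<le> 1"
  shows "measure \<nu> UNIV powr q \<le> partition_sum n q" "partition_sum n q \<le> 2 ^ n * (1 + measure \<nu> UNIV)"
proof -
  let ?p = "\<lambda>k. measure \<nu> (dyadic_cell n k)"
  let ?M = "measure \<nu> UNIV"
  have "?M powr q = (\<Sum>k\<in>charged_indices n. ?p k) * ?M powr (q - 1)"
    using total_mass_pos by (simp add: sum_charged_cell_masses powr_diff)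
  also have "\<dots> \<le> partition_sum n q"
    unfolding sum_distrib_right partition_sum_def
  proof (rule sum_mono)
    fix k assume "k \<in> charged_indices n"
    then have p: "0 < ?p k" by (simp add: charged_indices_def)
    have "?M powr (q - 1) \<le> ?p k powr (q - 1)"
      using p cell_mass_le assms by (intro powr_mono2') auto
    then have "?p k * ?M powr (q - 1) \<le> ?p k * ?p k powr (q - 1)"
      using p by (intro mult_left_mono) auto
    also have "\<dots> = ?p k powr q" using p by (simp add: powr_diff)
    finally show "?p k * ?M powr (q - 1) \<le> ?p k powr q" .
  qed
  finally show "?M powr q \<le> partition_sum n q" .
  have "partition_sum n q \<le> (\<Sum>k\<in>charged_indices n. 1 + ?p k)"
    unfolding partition_sum_def
  proof (rule sum_mono)
    fix k assume "k \<in> charged_indices n"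
    then have p: "0 < ?p k" by (simp add: charged_indices_def)
    show "?p k powr q \<le> 1 + ?p k"
    proof (cases "?p k \<le> 1")
      case True
      then have "?p k powr q \<le> 1" using assms p by (intro powr_le1) auto
      then show ?thesis using p by simp
    next
      case False
      then have "?p k powr q \<le> ?p k powr 1" using assms by (intro powr_mono) auto
      then show ?thesis using p by simp
    qed
  qed
  also have "\<dots> = real (card (charged_indices n)) + ?M"
    by (simp add: sum.distrib sum_charged_cell_masses)
  also have "\<dots> \<le> 2 ^ n + 2 ^ n * ?M"
  proof (intro add_mono)
    have "card (charged_indices n) \<le> card {..<2 ^ n :: nat}"
      by (intro card_mono) (auto simp: charged_indices_def)
    then have "real (card (charged_indices n)) \<le> real (2 ^ n)" by (simp only: of_nat_le_iff card_lessThan)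
    then show "real (card (charged_indices n)) \<le> 2 ^ n" by simp
    have "1 * ?M \<le> 2 ^ n * ?M" by (intro mult_right_mono) auto
    then show "?M \<le> 2 ^ n * ?M" by simp
  qed
  finally show "partition_sum n q \<le> 2 ^ n * (1 + ?M)" by (simp add: algebra_simps)
qed

lemma beta_finite:
  assumes q: "0 \<le> q" "q \<le> 1" and lim: "(\<lambda>n. ereal (beta_n \<nu> n q)) \<longlonglongrightarrow> l"
  shows "\<bar>l\<bar> \<noteq> \<infinity>"
proof -
  let ?M = "measure \<nu> UNIV"
  define C where "C = 1 + ln (1 + ?M) / ln 2"
  \<comment> \<open>The logarithm may have either sign; with the absolute value the bound for
    \<open>n = 1\<close> serves all \<open>n \<ge> 1\<close>.\<close>
  define c where "c = - \<bar>ln (?M powr q)\<bar> / ln 2"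
  have M: "?M > 0" by (rule total_mass_pos)
  have "c \<le> beta_n \<nu> n q \<and> beta_n \<nu> n q \<le> C" if n: "n \<ge> 1" for n
  proof
    have nL: "ln 2 \<le> real n * ln 2" using n by simp
    have "ln (partition_sum n q) \<le> ln (2 ^ n * (1 + ?M))"
      using partition_sum_bounds(2)[OF q, of n] partition_sum_pos[of n q] M by (intro ln_mono) auto
    also have "\<dots> = real n * ln 2 + ln (1 + ?M)" using M by (simp add: ln_mult ln_realpow)
    finally have "beta_n \<nu> n q \<le> (real n * ln 2 + ln (1 + ?M)) / (real n * ln 2)"
      unfolding beta_n_eq by (intro divide_right_mono) auto
    also have "\<dots> = 1 + ln (1 + ?M) / (real n * ln 2)" using n by (simp add: field_simps)
    also have "\<dots> \<le> C"
      unfolding C_def using M nL by (intro add_left_mono divide_left_mono) auto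
    finally show "beta_n \<nu> n q \<le> C" .
    have "c \<le> - \<bar>ln (?M powr q)\<bar> / (real n * ln 2)"
      unfolding c_def minus_divide_left[symmetric] neg_le_iff_le using nL n by (intro divide_left_mono) auto
    also have "\<dots> \<le> ln (?M powr q) / (real n * ln 2)" by (intro divide_right_mono) auto
    also have "\<dots> \<le> beta_n \<nu> n q"
      unfolding beta_n_eq using partition_sum_bounds(1)[OF q, of n] M
      by (intro divide_right_mono ln_mono) auto
    finally show "c \<le> beta_n \<nu> n q" .
  qed
  then have ev: "\<forall>\<^sub>F n in sequentially. ereal c \<le> ereal (beta_n \<nu> n q)"
      "\<forall>\<^sub>F n in sequentially. ereal (beta_n \<nu> n q) \<le> ereal C"
    by (auto simp: eventually_sequentially)
  have "ereal c \<le> l" by (rule tendsto_lowerbound[OF lim ev(1)]) simp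
  moreover have "l \<le> ereal C" by (rule tendsto_upperbound[OF lim ev(2)]) simp
  ultimately show ?thesis by (cases l) auto
qed

lemma partition_sum_less:
  assumes "beta \<nu> t < ereal c"
  shows "\<forall>\<^sub>F n in sequentially. partition_sum n t < 2 powr (real n * c)"
  using Limsup_lessD[OF assms[unfolded beta_def]] eventually_gt_at_top[of 0]
proof eventually_elim
  case (elim n)
  then have "ln (partition_sum n t) < real n * c * ln 2"
    by (simp add: beta_n_eq field_simps)
  then have "exp (ln (partition_sum n t)) < exp (real n * c * ln 2)" by simp
  then show ?case using partition_sum_pos by (simp add: powr_def)
qed

text \<open>Convergence of \<open>beta_n\<close> enters here: a limit superior would give this lower
  bound only for infinitely many \<open>n\<close>.\<close>

lemma partition_sum_greater:
  assumes "(\<lambda>n. ereal (beta_n \<nu> n t)) \<longlonglongrightarrow> ereal l" "c < l"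
  shows "\<forall>\<^sub>F n in sequentially. 2 powr (real n * c) < partition_sum n t"
proof -
  have "ereal c < ereal l" using assms(2) by simp
  from order_tendstoD(1)[OF assms(1) this] eventually_gt_at_top[of 0]
  show ?thesis
  proof eventually_elim
  case (elim n)
  then have "real n * c * ln 2 < ln (partition_sum n t)"
    by (simp add: beta_n_eq field_simps)
  then have "exp (real n * c * ln 2) < exp (ln (partition_sum n t))" by simp
  then show ?case using partition_sum_pos by (simp add: powr_def)
  qed
qed

text \<open>Write \<open>p powr q\<close> as \<open>p powr (q - t) * p powr t\<close>. For cells of
  mass above \<open>2 powr (- n A)\<close> take \<open>t = t1\<close>, where the first factor
  decreases in \<open>p\<close>; for those below \<open>2 powr (- n D)\<close> take
  \<open>t = t2\<close>, where it increases. The remaining cells are counted, each with the largest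
  possible term.\<close>

lemma partition_sum_split:
  assumes t: "q \<le> t1" "t2 \<le> q" and q: "0 \<le> q"
  shows "partition_sum n q \<le> 2 powr (real n * (A * (t1 - q))) * partition_sum n t1 +
    2 powr (- real n * (D * (q - t2))) * partition_sum n t2 +
    2 powr (- real n * (A * q)) * card {k. k < 2 ^ n \<and> 2 powr (- real n * D) \<le> measure \<nu> (dyadic_cell n k)}"
proof -
  let ?p = "\<lambda>k. measure \<nu> (dyadic_cell n k)"
  let ?G = "{k. k < 2 ^ n \<and> 2 powr (- real n * D) \<le> ?p k}"
  define s where "s k = 2 powr (real n * (A * (t1 - q))) * ?p k powr t1" for k
  define u where "u k = 2 powr (- real n * (D * (q - t2))) * ?p k powr t2" for k
  define v where "v k = (if k \<in> ?G then 2 powr (- real n * (A * q)) else 0)" for k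
  have nonneg: "0 \<le> s k" "0 \<le> u k" "0 \<le> v k" for k by (auto simp: s_def u_def v_def)
  have "?p k powr q \<le> s k + u k + v k" if "k \<in> charged_indices n" for k
  proof -
    have k: "0 < ?p k" "k < 2 ^ n" using that by (auto simp: charged_indices_def)
    consider "2 powr (- real n * A) < ?p k" | "?p k < 2 powr (- real n * D)"
      | "?p k \<le> 2 powr (- real n * A)" "k \<in> ?G" using k by force
    then show ?thesis
    proof cases
      case 1
      have "?p k powr (q - t1) \<le> (2 powr (- real n * A)) powr (q - t1)"
        using 1 t by (intro powr_mono2') auto
      also have "\<dots> = 2 powr (real n * (A * (t1 - q)))" by (simp add: powr_powr algebra_simps)
      finally have "?p k powr (q - t1) * ?p k powr t1 \<le> s k"
        unfolding s_def by (intro mult_right_mono) auto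
      also have "?p k powr (q - t1) * ?p k powr t1 = ?p k powr q"
        by (simp flip: powr_add)
      finally show ?thesis using nonneg[of k] by linarith
    next
      case 2
      have "?p k powr (q - t2) \<le> (2 powr (- real n * D)) powr (q - t2)"
        using 2 k t by (intro powr_mono2) auto
      also have "\<dots> = 2 powr (- real n * (D * (q - t2)))" by (simp add: powr_powr algebra_simps)
      finally have "?p k powr (q - t2) * ?p k powr t2 \<le> u k"
        unfolding u_def by (intro mult_right_mono) auto
      also have "?p k powr (q - t2) * ?p k powr t2 = ?p k powr q"
        by (simp flip: powr_add)
      finally show ?thesis using nonneg[of k] by linarith
    next
      case 3
      have "?p k powr q \<le> (2 powr (- real n * A)) powr q"
        using 3 k q by (intro powr_mono2) auto
      also have "\<dots> = v k" using 3 by (simp add: v_def powr_powr algebra_simps)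
      finally show ?thesis using nonneg[of k] by linarith
    qed
  qed
  then have "partition_sum n q \<le> (\<Sum>k\<in>charged_indices n. s k + u k + v k)"
    unfolding partition_sum_def by (rule sum_mono)
  also have "\<dots> = (\<Sum>k\<in>charged_indices n. s k) + (\<Sum>k\<in>charged_indices n. u k) + (\<Sum>k\<in>charged_indices n. v k)"
    by (simp add: sum.distrib)
  also have "(\<Sum>k\<in>charged_indices n. v k) \<le> (\<Sum>k<2 ^ n. v k)"
    by (intro sum_mono2) (auto simp: charged_indices_def nonneg)
  also have "(\<Sum>k<2 ^ n. v k) = (\<Sum>k\<in>?G. 2 powr (- real n * (A * q)))"
    unfolding v_def by (intro sum.mono_neutral_cong_right) auto
  also have "\<dots> = 2 powr (- real n * (A * q)) * card ?G" by simp
  finally show ?thesis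
    by (simp only: s_def u_def partition_sum_def sum_distrib_left)
qed

text \<open>
  The cells of mass above \<open>2 powr (- n A)\<close> are exponentially negligible in the sum for the exponent \<open>q\<close>
  by comparison with \<open>t1 > q\<close>, and those of mass below \<open>2 powr (- n D)\<close> by comparison with \<open>t2 < q\<close>.
\<close>

lemma card_heavy_cells:
  assumes lim: "(\<lambda>n. ereal (beta_n \<nu> n q)) \<longlonglongrightarrow> ereal l" and q: "0 \<le> q"
    and t1: "q < t1" "beta \<nu> t1 < ereal (l - A * (t1 - q))"
    and t2: "t2 < q" "beta \<nu> t2 < ereal (l + D * (q - t2))"
    and \<eta>: "0 < \<eta>"
  shows "\<forall>\<^sub>F n in sequentially. 2 powr (real n * (l - \<eta> + A * q)) / 2 \<le>
    card {k. k < 2 ^ n \<and> 2 powr (- real n * D) \<le> measure \<nu> (dyadic_cell n k)}"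
proof -
  obtain z1 where z1: "beta \<nu> t1 < ereal z1" "z1 < l - A * (t1 - q)"
    using ereal_dense2[OF t1(2)] by auto
  obtain z2 where z2: "beta \<nu> t2 < ereal z2" "z2 < l + D * (q - t2)"
    using ereal_dense2[OF t2(2)] by auto
  \<comment> \<open>A common slack: both comparison terms are at most
    \<open>2 powr (n * (l - \<kappa>))\<close>, whereas the full sum exceeds
    \<open>2 powr (n * (l - \<kappa> / 2))\<close>.\<close>
  define \<kappa> where "\<kappa> = min \<eta> (min (l - A * (t1 - q) - z1) (l + D * (q - t2) - z2))"
  have \<kappa>: "\<kappa> > 0" "\<kappa> \<le> \<eta>" "z1 \<le> l - A * (t1 - q) - \<kappa>" "z2 \<le> l + D * (q - t2) - \<kappa>"
    using z1 z2 \<eta> by (auto simp: \<kappa>_def)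
  have e1: "\<forall>\<^sub>F n in sequentially. partition_sum n t1 < 2 powr (real n * (l - A * (t1 - q) - \<kappa>))"
    by (rule partition_sum_less, rule less_le_trans[OF z1(1)]) (use \<kappa> in simp)
  have e2: "\<forall>\<^sub>F n in sequentially. partition_sum n t2 < 2 powr (real n * (l + D * (q - t2) - \<kappa>))"
    by (rule partition_sum_less, rule less_le_trans[OF z2(1)]) (use \<kappa> in simp)
  have e3: "\<forall>\<^sub>F n in sequentially. 2 powr (real n * (l - \<kappa> / 2)) < partition_sum n q"
    by (rule partition_sum_greater[OF lim]) (use \<kappa> in simp)
  \<comment> \<open>Then \<open>n * \<kappa> / 2 \<ge> 2\<close>, so the two comparison terms
    together use at most half of the sum.\<close>
  have e4: "\<forall>\<^sub>F n in sequentially. 4 / \<kappa> \<le> real n"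
    using filterlim_real_sequentially by (auto simp: filterlim_at_top)
  from e1 e2 e3 e4 show ?thesis
  proof eventually_elim
    case (elim n)
    let ?G = "{k. k < 2 ^ n \<and> 2 powr (- real n * D) \<le> measure \<nu> (dyadic_cell n k)}"
    have "2 powr (real n * (A * (t1 - q))) * partition_sum n t1 \<le>
        2 powr (real n * (A * (t1 - q))) * 2 powr (real n * (l - A * (t1 - q) - \<kappa>))"
      using elim(1) by (intro mult_left_mono) auto
    also have "\<dots> = 2 powr (real n * (l - \<kappa>))"
      by (simp add: algebra_simps flip: powr_add)
    finally have b1: "2 powr (real n * (A * (t1 - q))) * partition_sum n t1 \<le> 2 powr (real n * (l - \<kappa>))" .
    have "2 powr (- real n * (D * (q - t2))) * partition_sum n t2 \<le>
        2 powr (- real n * (D * (q - t2))) * 2 powr (real n * (l + D * (q - t2) - \<kappa>))"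
      using elim(2) by (intro mult_left_mono) auto
    also have "\<dots> = 2 powr (real n * (l - \<kappa>))"
      by (simp add: algebra_simps flip: powr_add)
    finally have b2: "2 powr (- real n * (D * (q - t2))) * partition_sum n t2 \<le> 2 powr (real n * (l - \<kappa>))" .
    have "2 * 2 powr (real n * (l - \<kappa>)) = 2 powr (1 + real n * (l - \<kappa>))"
      by (simp add: powr_add)
    also have "\<dots> \<le> 2 powr (real n * (l - \<kappa> / 2) - 1)"
      using elim(4) \<kappa> by (intro powr_mono) (auto simp: field_simps)
    also have "\<dots> = 2 powr (real n * (l - \<kappa> / 2)) / 2" by (simp add: powr_diff)
    finally have b3: "2 * 2 powr (real n * (l - \<kappa>)) \<le> 2 powr (real n * (l - \<kappa> / 2)) / 2" .
    have "2 powr (real n * (l - \<eta>)) \<le> 2 powr (real n * (l - \<kappa> / 2))"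
      using \<kappa> by (intro powr_mono mult_left_mono) auto
    then have "2 powr (real n * (l - \<eta>)) / 2 \<le> 2 powr (- real n * (A * q)) * card ?G"
      using partition_sum_split[of q t1 t2 n A D] t1 t2 q b1 b2 b3 elim(3) by linarith
    then have "2 powr (real n * (A * q)) * (2 powr (real n * (l - \<eta>)) / 2) \<le>
        2 powr (real n * (A * q)) * (2 powr (- real n * (A * q)) * card ?G)"
      by (intro mult_left_mono) auto
    also have "\<dots> = card ?G" by (simp flip: powr_add mult.assoc)
    finally have "2 powr (real n * (A * q)) * (2 powr (real n * (l - \<eta>)) / 2) \<le> card ?G" .
    moreover have "2 powr (real n * (l - \<eta> + A * q)) = 2 powr (real n * (A * q)) * 2 powr (real n * (l - \<eta>))"
      by (simp add: algebra_simps flip: powr_add)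
    ultimately show ?case by simp
  qed
qed

end

section \<open>From cell counts to eigenvalue growth, and removal of the error terms\<close>

section \<open>The lower spectral dimension\<close>

lemma ln_enat_ge: "enat m \<le> N \<Longrightarrow> 0 < m \<Longrightarrow> ereal (ln (real m)) \<le> ln_enat N"
  by (cases N) (auto simp: ln_enat_def)

context nonzero_interval_measure
begin

text \<open>At least one eigenvalue is counted eventually. This allows the final estimate to be
  reduced to positive exponents \<open>r\<close>.\<close>

lemma lower_spectral_dim_nonneg: "0 \<le> lower_spectral_dim \<nu>"
  unfolding lower_spectral_dim_def
proof (rule Liminf_bounded)
  show "\<forall>\<^sub>F x in at_top. 0 \<le> ln_enat (N_count \<nu> x) / ereal (ln x)"
    using N_count_ge_1[OF nonzero] eventually_gt_at_top[of 1]
  proof eventually_elim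
    case (elim x)
    then have "0 \<le> ln_enat (N_count \<nu> x)"
      using ln_enat_ge[of 1 "N_count \<nu> x"] by (simp add: one_enat_def zero_ereal_def)
    then show ?case using elim by (simp add: ereal_le_divide_pos)
  qed
qed

text \<open>At threshold \<open>x\<close> use a level \<open>n\<close> with
  \<open>2 powr (n * (1 + D))\<close> comparable to \<open>x / 3\<close>; the heavy cells of that
  level number about \<open>x powr (\<gamma> / (1 + D))\<close>. Constant factors disappear in the
  quotient of logarithms because \<open>r\<close> is strictly smaller than this exponent.\<close>

lemma lower_spectral_dim_ge:
  assumes card: "\<forall>\<^sub>F n in sequentially. 2 powr (real n * \<gamma>) / 2 \<le>
      card {k. k < 2 ^ n \<and> 2 powr (- real n * D) \<le> measure \<nu> (dyadic_cell n k)}"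
    and pos: "0 < \<gamma>" "0 < 1 + D" and r: "r * (1 + D) < \<gamma>"
  shows "ereal r \<le> lower_spectral_dim \<nu>"
  unfolding lower_spectral_dim_def
proof (rule Liminf_bounded)
  define \<theta> where "\<theta> = 1 + D"
  have \<theta>: "\<theta> > 0" "r < \<gamma> / \<theta>" using pos r by (auto simp: \<theta>_def field_simps)
  \<comment> \<open>The logarithmic losses: the factor 3 in \<open>x / 3\<close>, at most one level
    from rounding down, and the factor 12 between \<open>y\<close> and \<open>m\<close>.\<close>
  define C where "C = \<gamma> / \<theta> * ln 3 + \<gamma> * ln 2 + ln 12"
  define level where "level x = nat \<lfloor>log 2 (x / 3) / \<theta>\<rfloor>" for x
  have "filterlim (\<lambda>x. log 2 (x / 3) / \<theta>) at_top at_top" using \<theta> by real_asymp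
  then have level: "filterlim level at_top at_top"
    unfolding level_def
    by (intro filterlim_compose[OF filterlim_nat_sequentially] filterlim_compose[OF filterlim_floor_sequentially])
  have "filterlim (\<lambda>n. 2 powr (real n * \<gamma>)) at_top sequentially" using pos by real_asymp
  \<comment> \<open>From \<open>y / 2 \<le> 3 * m + 2\<close> the bound
    \<open>y / 12 \<le> m\<close> follows once \<open>y \<ge> 8\<close>.\<close>
  then have "\<forall>\<^sub>F n in sequentially. 8 \<le> 2 powr (real n * \<gamma>)" by (simp add: filterlim_at_top)
  with card have "\<forall>\<^sub>F n in sequentially. 8 \<le> 2 powr (real n * \<gamma>) \<and> 2 powr (real n * \<gamma>) / 2 \<le>
      card {k. k < 2 ^ n \<and> 2 powr (- real n * D) \<le> measure \<nu> (dyadic_cell n k)}"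
    by eventually_elim simp
  then have ev1: "\<forall>\<^sub>F x in at_top. 8 \<le> 2 powr (real (level x) * \<gamma>) \<and> 2 powr (real (level x) * \<gamma>) / 2 \<le>
      card {k. k < 2 ^ level x \<and> 2 powr (- real (level x) * D) \<le> measure \<nu> (dyadic_cell (level x) k)}"
    by (rule eventually_compose_filterlim[OF _ level])
  have ev2: "\<forall>\<^sub>F x in at_top. C / (\<gamma> / \<theta> - r) \<le> ln x"
    using ln_at_top by (simp add: filterlim_at_top)
  show "\<forall>\<^sub>F x in at_top. ereal r \<le> ln_enat (N_count \<nu> x) / ereal (ln x)"
    using ev1 ev2 eventually_gt_at_top[of 3]
  proof eventually_elim
    case (elim x)
    define n where "n = level x"
    define y where "y = 2 powr (real n * \<gamma>)"
    let ?G = "{k. k < 2 ^ n \<and> 2 powr (- real n * D) \<le> measure \<nu> (dyadic_cell n k)}"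
    \<comment> \<open>The two boundary cells carry no tent; dropping them costs at most 2 in the
      count.\<close>
    let ?K = "?G - {0, 2 ^ n - 1}"
    have y: "8 \<le> y" "y / 2 \<le> card ?G" using elim(1) by (simp_all add: n_def y_def)
    have "0 < log 2 (x / 3)" using elim(3) by simp
    then have floor: "0 \<le> log 2 (x / 3) / \<theta>" using \<theta> by simp
    then have n_le: "real n \<le> log 2 (x / 3) / \<theta>" by (simp add: n_def level_def)
    have n_ge: "log 2 (x / 3) / \<theta> - 1 \<le> real n" using floor by (simp add: n_def level_def)
    have "2 powr (real n * \<theta>) \<le> 2 powr (log 2 (x / 3))"
      using n_le \<theta> by (intro powr_mono) (auto simp: field_simps)
    then have x: "3 * 2 powr (real n * \<theta>) \<le> x" using elim(3) by simp
    have "3 * 2 ^ n \<le> x * 2 powr (- real n * D)"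
    proof -
      have "3 * 2 ^ n = 3 * (2 powr (real n * \<theta>) * 2 powr (- real n * D))"
        by (simp add: \<theta>_def algebra_simps powr_realpow flip: powr_add)
      also have "\<dots> \<le> x * 2 powr (- real n * D)"
        using x by (simp add: mult.assoc[symmetric])
      finally show ?thesis .
    qed
    moreover have "1 \<le> k \<and> k + 2 \<le> 2 ^ n" if "k \<in> ?K" for k using that by auto
    ultimately obtain m where m: "card ?K \<le> 3 * m" "enat m \<le> N_count \<nu> x"
      using card_heavy_cells_le_N_count[of ?K n "2 powr (- real n * D)" x] by auto
    have "card ?G - card {0, 2 ^ n - 1 :: nat} \<le> card ?K"
      by (rule diff_card_le_card_Diff) simp
    moreover have "card {0, 2 ^ n - 1 :: nat} \<le> 2" by (simp add: card_insert_if)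
    ultimately have "card ?G \<le> 3 * m + 2" using m(1) by linarith
    then have "real (card ?G) \<le> 3 * real m + 2" by linarith
    then have m_ge: "y / 12 \<le> real m" using y by linarith
    then have m_pos: "0 < m" using y by (cases m) auto
    have "(\<gamma> / \<theta> - r) * ln x \<ge> C" using elim(2) \<theta> by (simp add: field_simps)
    then have "r * ln x \<le> \<gamma> / \<theta> * ln x - C" by (simp add: algebra_simps)
    also have "\<dots> = (log 2 (x / 3) / \<theta> - 1) * (\<gamma> * ln 2) - ln 12"
      using elim(3) by (simp add: C_def log_def ln_div algebra_simps diff_divide_distrib)
    also have "\<dots> \<le> real n * (\<gamma> * ln 2) - ln 12"
      using n_ge pos by (intro diff_right_mono mult_right_mono) auto
    also have "\<dots> = ln (y / 12)" by (simp add: y_def ln_div ln_powr)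
    also have "\<dots> \<le> ln (real m)" using m_ge y by (intro ln_mono) auto
    finally have "ereal (r * ln x) \<le> ln_enat (N_count \<nu> x)"
      using ln_enat_ge[OF m(2) m_pos] by (meson ereal_less_eq(3) order_trans)
    then show ?case using elim(3) by (simp add: ereal_le_divide_pos mult.commute)
  qed
qed

text \<open>With \<open>D < 0\<close> some cell would eventually have mass above the total mass. The
  lemma yields \<open>b \<ge> 0\<close>, hence a positive denominator \<open>1 + b\<close>.\<close>

lemma heavy_exponent_nonneg:
  assumes "\<forall>\<^sub>F n in sequentially. 2 powr (real n * \<gamma>) / 2 \<le>
      card {k. k < 2 ^ n \<and> 2 powr (- real n * D) \<le> measure \<nu> (dyadic_cell n k)}"
  shows "0 \<le> D"
proof (rule ccontr)
  assume "\<not> 0 \<le> D"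
  then have "0 < - D" by simp
  have "filterlim (\<lambda>n. 2 powr (real n * d)) at_top sequentially" if "0 < d" for d :: real
    using that by real_asymp
  from this[OF \<open>0 < - D\<close>] have "\<forall>\<^sub>F n in sequentially. measure \<nu> UNIV < 2 powr (real n * (- D))"
    by (rule filterlim_at_top_dense[THEN iffD1, THEN spec])
  with assms have "\<forall>\<^sub>F n :: nat in sequentially. False"
  proof eventually_elim
    case (elim n)
    have "0 < 2 powr (real n * \<gamma>) / 2" by simp
    also note elim(1)
    finally have "{k. k < 2 ^ n \<and> 2 powr (- real n * D) \<le> measure \<nu> (dyadic_cell n k)} \<noteq> {}"
      by (auto simp only: card.empty)
    then obtain k where "2 powr (- real n * D) \<le> measure \<nu> (dyadic_cell n k)" by auto
    with elim(2) show False using cell_mass_le[of n k] by simp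
  qed
  then show False by simp
qed

end

text \<open>Since \<open>- (a - \<epsilon>)\<close> is not a subgradient, its supporting line fails
  at some \<open>t1\<close>. The line of the subgradient \<open>- a\<close> lies below
  \<open>beta\<close> there, and comparing the two lines forces \<open>t1 > q\<close>. The same
  argument with \<open>b + \<epsilon>\<close> gives a point to the left of \<open>q\<close>.\<close>

lemma subgradient_separates:
  fixes q a b l \<epsilon> :: real
  assumes q: "beta \<nu> q = ereal l" and "a \<le> b" and sub: "uminus ` subdiff_beta \<nu> q = {a..b}" and "0 < \<epsilon>"
  shows "\<exists>t1>q. beta \<nu> t1 < ereal (l - (a - \<epsilon>) * (t1 - q))"
    and "\<exists>t2<q. beta \<nu> t2 < ereal (l + (b + \<epsilon>) * (q - t2))"
proof -
  have mem: "- c \<in> subdiff_beta \<nu> q \<longleftrightarrow> c \<in> {a..b}" for c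
    using sub by (metis (no_types, lifting) add.inverse_inverse image_iff)
  have le: "ereal (- c * (t - q) + l) \<le> beta \<nu> t" if "c \<in> {a..b}" for c t
    using mem[of c] that by (auto simp: subdiff_beta_def q)
  have ex: "\<exists>t. beta \<nu> t < ereal (- c * (t - q) + l)" if "c \<notin> {a..b}" for c
    using mem[of c] that by (auto simp: subdiff_beta_def q not_le)
  obtain t1 where t1: "beta \<nu> t1 < ereal (- (a - \<epsilon>) * (t1 - q) + l)" using ex[of "a - \<epsilon>"] assms by auto
  have "ereal (- a * (t1 - q) + l) < ereal (- (a - \<epsilon>) * (t1 - q) + l)"
    using le_less_trans[OF le t1, of a] assms by simp
  then have "0 < \<epsilon> * (t1 - q)" by (simp add: algebra_simps)
  then have "q < t1" using \<open>0 < \<epsilon>\<close> by (simp add: zero_less_mult_iff)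
  then show "\<exists>t1>q. beta \<nu> t1 < ereal (l - (a - \<epsilon>) * (t1 - q))"
    using t1 by (intro exI[of _ t1]) (simp add: algebra_simps)
  obtain t2 where t2: "beta \<nu> t2 < ereal (- (b + \<epsilon>) * (t2 - q) + l)" using ex[of "b + \<epsilon>"] assms by auto
  have "ereal (- b * (t2 - q) + l) < ereal (- (b + \<epsilon>) * (t2 - q) + l)"
    using le_less_trans[OF le t2, of b] assms by simp
  then have "0 < \<epsilon> * (q - t2)" by (simp add: algebra_simps)
  then have "t2 < q" using \<open>0 < \<epsilon>\<close> by (simp add: zero_less_mult_iff)
  then show "\<exists>t2<q. beta \<nu> t2 < ereal (l + (b + \<epsilon>) * (q - t2))"
    using t2 by (intro exI[of _ t2]) (simp add: algebra_simps)
qed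

theorem proposition1p5:
  fixes \<nu> :: "real measure" and q a b :: real
  assumes "finite_measure \<nu>"
    and "sets \<nu> = sets borel"
    and "emeasure \<nu> (- {0<..<1}) = 0"
    and "emeasure \<nu> {0<..<1} \<noteq> 0"
    and "0 \<le> q" and "q \<le> 1"
    and "(\<lambda>n. ereal (beta_n \<nu> n q)) \<longlonglongrightarrow> beta \<nu> q"
    and "a \<le> b"
    and "uminus ` subdiff_beta \<nu> q = {a..b}"
  shows "(ereal (a * q) + beta \<nu> q) / ereal (1 + b) \<le> lower_spectral_dim \<nu>"
proof -
  interpret finite_measure \<nu> by fact
  interpret nonzero_interval_measure \<nu> by standard (fact assms)+
  obtain l where l: "beta \<nu> q = ereal l"
    using beta_finite[OF assms(5-7)] by (cases "beta \<nu> q") auto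
  have heavy: "\<forall>\<^sub>F n in sequentially. 2 powr (real n * (l - \<epsilon> + (a - \<epsilon>) * q)) / 2 \<le>
      card {k. k < 2 ^ n \<and> 2 powr (- real n * (b + \<epsilon>)) \<le> measure \<nu> (dyadic_cell n k)}"
    if "0 < \<epsilon>" for \<epsilon>
    using subgradient_separates[OF l assms(8,9) that] card_heavy_cells[OF assms(7)[unfolded l] assms(5)] that
    by blast
  have b: "0 \<le> b"
  proof (rule field_le_epsilon)
    show "0 \<le> b + \<epsilon>" if "0 < \<epsilon>" for \<epsilon> by (rule heavy_exponent_nonneg[OF heavy[OF that]])
  qed
  have "ereal ((a * q + l) / (1 + b)) \<le> lower_spectral_dim \<nu>"
  proof (rule ccontr)
    assume "\<not> ?thesis"
    then obtain r where r: "lower_spectral_dim \<nu> < ereal r" "r < (a * q + l) / (1 + b)"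
      using ereal_dense2[of "lower_spectral_dim \<nu>" "ereal ((a * q + l) / (1 + b))"]
      by (auto simp: not_le)
    have "0 < ereal r" using lower_spectral_dim_nonneg r(1) by (rule le_less_trans)
    then have r0: "0 < r" by simp
    have gap: "0 < a * q + l - r * (1 + b)" using r(2) b by (simp add: field_simps)
    \<comment> \<open>Perturbing \<open>a\<close>, \<open>b\<close> and \<open>l\<close> by
      \<open>\<epsilon>\<close> costs
      \<open>(r + 1 + q) * \<epsilon> \<le> (r + 2) * \<epsilon>\<close>, as
      \<open>q \<le> 1\<close>; the denominator \<open>r + 3\<close> keeps this strictly below the
      gap.\<close>
    define \<epsilon> where "\<epsilon> = (a * q + l - r * (1 + b)) / (r + 3)"
    have \<epsilon>: "0 < \<epsilon>" using gap r0 by (simp add: \<epsilon>_def)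
    have "(r + 2) * \<epsilon> < (r + 3) * \<epsilon>" using \<epsilon> by simp
    also have "\<dots> = a * q + l - r * (1 + b)" using r0 by (simp add: \<epsilon>_def)
    finally have "(r + 2) * \<epsilon> < a * q + l - r * (1 + b)" .
    moreover have "\<epsilon> * q \<le> \<epsilon> * 1" using \<epsilon> assms(6) by (intro mult_left_mono) auto
    ultimately have less: "r * (1 + (b + \<epsilon>)) < l - \<epsilon> + (a - \<epsilon>) * q" by (simp add: algebra_simps)
    have "0 < r * (1 + (b + \<epsilon>))" using r0 b \<epsilon> by (intro mult_pos_pos) auto
    then have "ereal r \<le> lower_spectral_dim \<nu>"
      using less b \<epsilon> by (intro lower_spectral_dim_ge[OF heavy[OF \<epsilon>]]) auto
    with r(1) show False by simp
  qed
  then show ?thesis using b by (simp add: l)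
qed

end
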